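(* Let $(H,\langle\!\langle\cdot,\cdot\rangle\!\rangle,\nabla^+,\nabla^-,\Psi)$ be a family of Legendre bundles over $B\times D$, where $D=\operatorname{Spec} k[[u]]$. Then for each fixed $u$ (in the formal sense), the restriction $H_u=H|_{B\times\{u\}}$ together with the induced data $(J,\boldsymbol{\omega}^S_u,\nabla_u)$ defined by (i) $J=+\mathrm{id}$ on $H^+_u$ and $J=-\mathrm{id}$ on $H^-_u$, (ii) $\boldsymbol{\omega}^S_u(X,Y)=\langle\!\langle JX,Y\rangle\!\rangle$, (iii) $\nabla_u=\nabla^+_u\oplus\nabla^-_u$, is a para-Kähler vector bundle over $B$. In particular, the family $(H,\langle\!\langle\cdot,\cdot\rangle\!\rangle,\nabla^+,\nabla^-,\Psi)$ is a formal deformation, with deformation parameter $u$, of the para-Kähler bundle at $u=0$ (that of the classical Legendre bundle obtained by restricting to $u=0$).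
   Context: Conventions. $k$ is $\mathbb{R}$ or $\mathbb{C}$, and $D=\operatorname{Spec} k[[u]]$ is the formal disk with coordinate $u$. For a smooth manifold $B$, objects over $B\times D$ are smooth along $B$ and formal in $u$: functions on $B\times D$ are formal power series in $u$ whose coefficients are smooth functions on $B$ (tensored with $k$ if $k=\mathbb{C}$), bundles, pairings and connections are defined over this ring, and vector fields on $B\times D$ are spanned over it by vector fields on $B$ and $\partial_u$. $C^\infty(B)$ denotes real-valued smooth functions. Statements "for each fixed $u$ (in the formal sense)" mean: treat $u$ as a constant parameter (so connections are differentiated only along $B$; $\nabla^{\pm}_u$ denote the resulting connections on $H^{\pm}_u$) and require all identities as identities of formal power series in $u$. A formal deformation of a structure over $B$ is such a structure formal in $u$ whose reduction at $u=0$ is the given one. Classical Legendre bundle over $B$: a quintuple $(H,\langle\!\langle\cdot,\cdot\rangle\!\rangle,\nabla^+,\nabla^-,\Psi)$ where: (1) $H=H^+\oplus H^-$ is a vector bundle with isomorphisms $H^+\cong TB$, $H^-\cong T^*B$; (2) $\langle\!\langle\cdot,\cdot\rangle\!\rangle$ is a non-degenerate symmetric bilinear form on $H$ vanishing on $H^+\otimes H^+$ and on $H^-\otimes H^-$, with $\langle\!\langle X,\alpha\rangle\!\rangle=\alpha(X)$ for $X\in H^+$, $\alpha\in H^-$; (3) $\nabla^{\pm}$ are flat connections on $H^{\pm}$ with $Z\langle\!\langle X,\alpha\rangle\!\rangle=\langle\!\langle\nabla^+_ZX,\alpha\rangle\!\rangle+\langle\!\langle X,\nabla^-_Z\alpha\rangle\!\rangle$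 for all sections $X$ of $H^+$, $\alpha$ of $H^-$ and vector fields $Z$; here $\nabla^+$, viewed on $TB$, is torsion-free, so that local $\nabla^+$-flat coordinates $(\theta^i)$ (with $\partial_i$ parallel) exist; (4) $\Psi\in C^\infty(B)$ is strictly convex with respect to the flat structure of $\nabla^+$ (positive-definite Hessian in $\nabla^+$-flat coordinates), with associated Legendre morphism $\mathscr{L}_\Psi:H^+\to H^-$, $\mathscr{L}_\Psi(\partial_j)=\sum_i(\partial_i\partial_j\Psi)\,d\theta^i$. Family of Legendre bundles over $B\times D$ (with projection $\pi_B$ to $B$): a quintuple $(H,\langle\!\langle\cdot,\cdot\rangle\!\rangle,\nabla^+,\nabla^-,\Psi)$ where: $H=H^+\oplus H^-$ is a vector bundle over $B\times D$ with isomorphisms $H^+\cong\pi_B^*TB$, $H^-\cong\pi_B^*T^*B$ independent of $u$; $\langle\!\langle\cdot,\cdot\rangle\!\rangle$ is a non-degenerate symmetric bilinear form on $H$ vanishing on $H^+\otimes H^+$ and $H^-\otimes H^-$ and inducing the canonical evaluation on $H^+\otimes H^-$; $\nabla^{\pm}$ are flat connections on $H^{\pm}$ satisfying the duality condition $Z\langle\!\langle X,\alpha\rangle\!\rangle=\langle\!\langle\nabla^+_ZX,\alpha\rangle\!\rangle+\langle\!\langle X,\nabla^-_Z\alpha\rangle\!\rangle$ for all sections $X$ of $H^+$, $\alpha$ of $H^-$ and all vector fields $Z$ on $B\times D$ (in particular $\partial_u$); $\Psi=\psi+u\psi_1+u^2\psi_2+\cdots$ is a formal power series in $u$ with coefficients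 in $C^\infty(B)$ whose Hessian $\partial_i\partial_j\Psi$ is positive definite in the formal sense, meaning that the Hessian of $\psi$ is positive definite while $\psi_1,\psi_2,\dots$ are arbitrary; and the data satisfy the conditions of a classical Legendre bundle for each fixed $u$. Para-Kähler vector bundle over $B$: a quadruple $(H,J,\boldsymbol{\omega}^S,\nabla)$ where $H$ is a real vector bundle over $B$ (for the formal family: a bundle over the ring of formal power series in $u$ whose coefficients are smooth functions on $B$, tensored with $k$ if $k=\mathbb{C}$); $J$ is a vector bundle endomorphism of $H$ with $J^2=\mathrm{id}_H$ such that $\ker(J-\mathrm{id}_H)$ and $\ker(J+\mathrm{id}_H)$ have equal rank; $\boldsymbol{\omega}^S$ is a non-degenerate skew-symmetric bilinear form on the fibres of $H$ with $\boldsymbol{\omega}^S(JX,JY)=-\boldsymbol{\omega}^S(X,Y)$ for all $X,Y$; and $\nabla$ is a flat connection on $H$ with $\nabla J=0$ and $\nabla\boldsymbol{\omega}^S=0$. *)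

theory Defs
  imports "HOL-Analysis.Analysis" "HOL-Computational_Algebra.Formal_Power_Series"
begin

unbundle no vec_syntax
unbundle fps_syntax

text \<open>
  The ground field is a type \<open>'k::real_normed_field\<close>. The instances \<open>real\<close> and \<open>complex\<close> are
  the two intended cases; by Gelfand--Mazur every other instance is isomorphic to one of them.

  A space is given by a ``structure sheaf'' \<open>\<O>\<close>: \<open>\<O> W f\<close> says that \<open>f\<close>, whose values lie
  in the coefficient ring \<open>'r\<close>, is a function on the open set \<open>W\<close>. The manifold \<open>B\<close> has
  \<open>'r = 'k\<close> and \<open>\<O> = smooth A\<close>; the product \<open>B \<times> D\<close> has \<open>'r = 'k fps\<close> and
  \<open>\<O> = formal_smooth A\<close>. Bundles, connections etc. are defined once for both.
\<close>

section \<open>Smooth manifolds and formal functions\<close>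

primrec Ck_on :: "nat \<Rightarrow> 'e::euclidean_space set \<Rightarrow> ('e \<Rightarrow> 'v::real_normed_vector) \<Rightarrow> bool" where
  "Ck_on 0 S f \<longleftrightarrow> continuous_on S f"
| "Ck_on (Suc n) S f \<longleftrightarrow>
     f differentiable_on S \<and> (\<forall>v. Ck_on n S (\<lambda>x. frechet_derivative f (at x) v))"

text \<open>The functions below are used on open sets only.\<close>

definition Cinf_on :: "'e::euclidean_space set \<Rightarrow> ('e \<Rightarrow> 'v::real_normed_vector) \<Rightarrow> bool" where
  "Cinf_on S f \<longleftrightarrow> (\<forall>n. Ck_on n S f)"

type_synonym ('b, 'e) atlas = "('b set \<times> ('b \<Rightarrow> 'e)) set"

definition smooth_chart ::
  "('b::topological_space, 'e::euclidean_space) atlas \<Rightarrow> 'b set \<Rightarrow> ('b \<Rightarrow> 'e) \<Rightarrow> bool" where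
  "smooth_chart A U \<phi> \<longleftrightarrow>
     open U \<and> open (\<phi> ` U) \<and> homeomorphism U (\<phi> ` U) \<phi> (inv_into U \<phi>) \<and>
     (\<forall>(V, \<psi>) \<in> A.
        Cinf_on (\<phi> ` (U \<inter> V)) (\<psi> \<circ> inv_into U \<phi>) \<and>
        Cinf_on (\<psi> ` (U \<inter> V)) (\<phi> \<circ> inv_into V \<psi>))"

definition smooth_atlas ::
  "('b::{t2_space, second_countable_topology}, 'e::euclidean_space) atlas \<Rightarrow> bool" where
  "smooth_atlas A \<longleftrightarrow> (\<Union>(U, \<phi>) \<in> A. U) = UNIV \<and> (\<forall>(U, \<phi>) \<in> A. smooth_chart A U \<phi>)"

definition smooth ::
  "('b::topological_space, 'e::euclidean_space) atlas \<Rightarrow> 'b set \<Rightarrow> ('b \<Rightarrow> 'v::real_normed_vector) \<Rightarrow> bool"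
  where
  "smooth A W f \<longleftrightarrow> (\<forall>(U, \<phi>) \<in> A. Cinf_on (\<phi> ` (U \<inter> W)) (f \<circ> inv_into U \<phi>))"

definition formal_smooth ::
  "('b::topological_space, 'e::euclidean_space) atlas \<Rightarrow> 'b set \<Rightarrow> ('b \<Rightarrow> 'v::real_normed_vector fps) \<Rightarrow> bool"
  where
  "formal_smooth A W f \<longleftrightarrow> (\<forall>n. smooth A W (\<lambda>b. f b $ n))"

section \<open>Tangent vectors, covectors and vector fields\<close>

type_synonym ('b, 'r) tvec = "('b \<Rightarrow> 'r) \<Rightarrow> 'r"
type_synonym ('b, 'r) tcovec = "('b, 'r) tvec \<Rightarrow> 'r"
type_synonym ('b, 'r) vfield = "('b \<Rightarrow> 'r) \<Rightarrow> ('b \<Rightarrow> 'r)"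
type_synonym ('b, 'r) sheaf = "'b set \<Rightarrow> ('b \<Rightarrow> 'r) \<Rightarrow> bool"

text \<open>
  Derivations linear over the coefficient ring, normalised to vanish outside the function ring.
  For \<open>\<O> = formal_smooth A\<close> these are \<open>k[[u]]\<close>-linear, so \<open>tangent \<O> b\<close> is
  \<open>(T\<^sub>b B \<otimes> k)[[u]]\<close>, i.e. the fibre of \<open>\<pi>\<^sub>B\<^sup>* TB\<close>, and \<open>vector_fields \<O>\<close> are the vector fields
  along \<open>B\<close> with coefficients formal in \<open>u\<close> (those that treat \<open>u\<close> as a constant).
\<close>

definition tangent :: "('b, 'r::comm_ring_1) sheaf \<Rightarrow> 'b \<Rightarrow> ('b, 'r) tvec set" where
  "tangent \<O> b = {D.
     (\<forall>f. \<not> \<O> UNIV f \<longrightarrow> D f = 0) \<and>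
     (\<forall>f g. \<O> UNIV f \<longrightarrow> \<O> UNIV g \<longrightarrow>
        D (\<lambda>x. f x + g x) = D f + D g \<and>
        D (\<lambda>x. f x * g x) = D f * g b + f b * D g) \<and>
     (\<forall>c f. \<O> UNIV f \<longrightarrow> D (\<lambda>x. c * f x) = c * D f)}"

definition cotangent :: "('b, 'r::comm_ring_1) sheaf \<Rightarrow> 'b \<Rightarrow> ('b, 'r) tcovec set" where
  "cotangent \<O> b = {\<alpha>.
     (\<forall>D. D \<notin> tangent \<O> b \<longrightarrow> \<alpha> D = 0) \<and>
     (\<forall>D \<in> tangent \<O> b. \<forall>E \<in> tangent \<O> b. \<alpha> (\<lambda>f. D f + E f) = \<alpha> D + \<alpha> E) \<and>
     (\<forall>c. \<forall>D \<in> tangent \<O> b. \<alpha> (\<lambda>f. c * D f) = c * \<alpha> D)}"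

definition vector_fields :: "('b, 'r::comm_ring_1) sheaf \<Rightarrow> ('b, 'r) vfield set" where
  "vector_fields \<O> = {Z. (\<forall>b. (\<lambda>f. Z f b) \<in> tangent \<O> b) \<and> (\<forall>f. \<O> UNIV f \<longrightarrow> \<O> UNIV (Z f))}"

text \<open>All vector fields on \<open>B \<times> D\<close>: sums of a vector field along \<open>B\<close> and a multiple of \<open>\<partial>\<^sub>u\<close>.\<close>

definition total_vector_fields ::
  "('b::topological_space, 'e::euclidean_space) atlas \<Rightarrow> ('b, 'k::real_normed_field fps) vfield set" where
  "total_vector_fields A =
     {\<lambda>f b. if formal_smooth A UNIV f then Z f b + g b * fps_deriv (f b) else 0 | Z g.
        Z \<in> vector_fields (formal_smooth A) \<and> formal_smooth A UNIV g}"

definition bracket :: "('b, 'r::comm_ring_1) vfield \<Rightarrow> ('b, 'r) vfield \<Rightarrow> ('b, 'r) vfield" where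
  "bracket Z W = (\<lambda>f b. Z (W f) b - W (Z f) b)"

section \<open>Vector bundles\<close>

text \<open>
  The fibres are submodules of one ambient module (e.g. the direct sum of all fibres), which
  carries no topology of its own: the smooth structure comes from the local frames
  \<open>(U, r, e)\<close>, where \<open>e 0, \<dots>, e (r - 1)\<close> is a frame over \<open>U\<close>. Sections are total functions
  on \<open>'b\<close>, only the values on the open set considered being relevant.
\<close>

record ('b, 'r, 'h) vbundle =
  smul :: "'r \<Rightarrow> 'h \<Rightarrow> 'h"
  fibre :: "'b \<Rightarrow> 'h set"
  frames :: "('b set \<times> nat \<times> (nat \<Rightarrow> 'b \<Rightarrow> 'h)) set"

definition is_basis ::
  "('r::comm_ring_1 \<Rightarrow> 'h \<Rightarrow> 'h::ab_group_add) \<Rightarrow> 'h set \<Rightarrow> nat \<Rightarrow> (nat \<Rightarrow> 'h) \<Rightarrow> bool" where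
  "is_basis s F r e \<longleftrightarrow> (\<forall>i<r. e i \<in> F) \<and>
     (\<forall>x\<in>F. \<exists>!c. (\<forall>i\<ge>r. c i = 0) \<and> x = (\<Sum>i<r. s (c i) (e i)))"

definition vector_bundle ::
  "('b::topological_space, 'r::comm_ring_1) sheaf \<Rightarrow> ('b, 'r, 'h::ab_group_add) vbundle \<Rightarrow> bool" where
  "vector_bundle \<O> H \<longleftrightarrow>
     module (smul H) \<and> (\<forall>b. module.subspace (smul H) (fibre H b)) \<and>
     (\<Union>(U, r, e) \<in> frames H. U) = UNIV \<and>
     (\<forall>(U, r, e) \<in> frames H. open U \<and> (\<forall>b\<in>U. is_basis (smul H) (fibre H b) r (\<lambda>i. e i b))) \<and>
     (\<forall>(U, r, e) \<in> frames H. \<forall>(V, q, f) \<in> frames H. \<forall>i<r.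
        \<exists>c. (\<forall>j<q. \<O> (U \<inter> V) (c j)) \<and>
            (\<forall>b \<in> U \<inter> V. e i b = (\<Sum>j<q. smul H (c j b) (f j b))))"

definition section_on ::
  "('b::topological_space, 'r::comm_ring_1) sheaf \<Rightarrow> ('b, 'r, 'h::ab_group_add) vbundle \<Rightarrow>
     'b set \<Rightarrow> ('b \<Rightarrow> 'h) \<Rightarrow> bool" where
  "section_on \<O> H W s \<longleftrightarrow> (\<forall>b\<in>W. s b \<in> fibre H b) \<and>
     (\<forall>(U, r, e) \<in> frames H.
        \<exists>c. (\<forall>i<r. \<O> (W \<inter> U) (c i)) \<and>
            (\<forall>b \<in> W \<inter> U. s b = (\<Sum>i<r. smul H (c i b) (e i b))))"

definition sections ::
  "('b::topological_space, 'r::comm_ring_1) sheaf \<Rightarrow> ('b, 'r, 'h::ab_group_add) vbundle \<Rightarrow> ('b \<Rightarrow> 'h) set"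
  where
  "sections \<O> H = {s. section_on \<O> H UNIV s}"

definition direct_sum_bundle ::
  "('b::topological_space, 'r::comm_ring_1) sheaf \<Rightarrow> ('b, 'r, 'h::ab_group_add) vbundle \<Rightarrow>
     ('b, 'r, 'h) vbundle \<Rightarrow> ('b, 'r, 'h) vbundle \<Rightarrow> bool" where
  "direct_sum_bundle \<O> H P M \<longleftrightarrow>
     smul P = smul H \<and> smul M = smul H \<and>
     (\<forall>b. fibre P b \<inter> fibre M b = {0} \<and>
          fibre H b = {p + m | p m. p \<in> fibre P b \<and> m \<in> fibre M b}) \<and>
     (\<forall>W p m. open W \<longrightarrow> (\<forall>b\<in>W. p b \<in> fibre P b \<and> m b \<in> fibre M b) \<longrightarrow>
        (section_on \<O> H W (\<lambda>b. p b + m b) \<longleftrightarrow> section_on \<O> P W p \<and> section_on \<O> M W m))"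

definition linear_on ::
  "('r \<Rightarrow> 'h \<Rightarrow> 'h::ab_group_add) \<Rightarrow> 'h set \<Rightarrow> ('r \<Rightarrow> 'g \<Rightarrow> 'g::ab_group_add) \<Rightarrow> ('h \<Rightarrow> 'g) \<Rightarrow> bool" where
  "linear_on s F t \<phi> \<longleftrightarrow>
     (\<forall>x\<in>F. \<forall>y\<in>F. \<phi> (x + y) = \<phi> x + \<phi> y) \<and> (\<forall>c. \<forall>x\<in>F. \<phi> (s c x) = t c (\<phi> x))"

text \<open>
  Isomorphisms \<open>P \<cong> TB\<close> and \<open>M \<cong> T\<^sup>*B\<close>. A (local) vector field is smooth iff it maps global
  functions to functions, and a (local) 1-form is smooth iff its values on global vector fields
  are functions.
\<close>

definition tangent_iso ::
  "('b::topological_space, 'r::comm_ring_1) sheaf \<Rightarrow> ('b, 'r, 'h::ab_group_add) vbundle \<Rightarrow>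
     ('b \<Rightarrow> 'h \<Rightarrow> ('b, 'r) tvec) \<Rightarrow> bool" where
  "tangent_iso \<O> P \<tau> \<longleftrightarrow>
     (\<forall>b. bij_betw (\<tau> b) (fibre P b) (tangent \<O> b) \<and>
          (\<forall>f. linear_on (smul P) (fibre P b) (*) (\<lambda>x. \<tau> b x f))) \<and>
     (\<forall>W s. open W \<longrightarrow> (\<forall>b\<in>W. s b \<in> fibre P b) \<longrightarrow>
        (section_on \<O> P W s \<longleftrightarrow> (\<forall>f. \<O> UNIV f \<longrightarrow> \<O> W (\<lambda>b. \<tau> b (s b) f))))"

definition cotangent_iso ::
  "('b::topological_space, 'r::comm_ring_1) sheaf \<Rightarrow> ('b, 'r, 'h::ab_group_add) vbundle \<Rightarrow>
     ('b \<Rightarrow> 'h \<Rightarrow> ('b, 'r) tcovec) \<Rightarrow> bool" where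
  "cotangent_iso \<O> M \<tau> \<longleftrightarrow>
     (\<forall>b. bij_betw (\<tau> b) (fibre M b) (cotangent \<O> b) \<and>
          (\<forall>D. linear_on (smul M) (fibre M b) (*) (\<lambda>x. \<tau> b x D))) \<and>
     (\<forall>W s. open W \<longrightarrow> (\<forall>b\<in>W. s b \<in> fibre M b) \<longrightarrow>
        (section_on \<O> M W s \<longleftrightarrow>
           (\<forall>Z \<in> vector_fields \<O>. \<O> W (\<lambda>b. \<tau> b (s b) (\<lambda>f. Z f b)))))"

section \<open>Pairings and connections\<close>

definition bilinear_form ::
  "('b::topological_space, 'r::comm_ring_1) sheaf \<Rightarrow> ('b, 'r, 'h::ab_group_add) vbundle \<Rightarrow>
     ('b \<Rightarrow> 'h \<Rightarrow> 'h \<Rightarrow> 'r) \<Rightarrow> bool" where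
  "bilinear_form \<O> H \<beta> \<longleftrightarrow>
     (\<forall>b. \<forall>x \<in> fibre H b.
        linear_on (smul H) (fibre H b) (*) (\<beta> b x) \<and>
        linear_on (smul H) (fibre H b) (*) (\<lambda>y. \<beta> b y x)) \<and>
     (\<forall>W s t. open W \<longrightarrow> section_on \<O> H W s \<longrightarrow> section_on \<O> H W t \<longrightarrow>
        \<O> W (\<lambda>b. \<beta> b (s b) (t b)))"

text \<open>
  Non-degenerate: \<open>x \<mapsto> \<beta>(x, _)\<close> is a bijection from each fibre onto its dual module. Over
  \<open>k[[u]]\<close> this is stronger than injectivity and means that the Gram determinant is a unit.
\<close>

definition nondegenerate ::
  "('b, 'r::comm_ring_1, 'h::ab_group_add) vbundle \<Rightarrow> ('b \<Rightarrow> 'h \<Rightarrow> 'h \<Rightarrow> 'r) \<Rightarrow> bool" where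
  "nondegenerate H \<beta> \<longleftrightarrow>
     (\<forall>b \<mu>. linear_on (smul H) (fibre H b) (*) \<mu> \<longrightarrow>
        (\<exists>!x. x \<in> fibre H b \<and> (\<forall>y \<in> fibre H b. \<beta> b x y = \<mu> y)))"

text \<open>
  A connection differentiates in the directions of a given module \<open>V\<close> of vector fields. The
  same operator \<open>nab\<close> is a connection over \<open>B \<times> D\<close> for \<open>V = total_vector_fields A\<close>, and its
  restriction to fixed \<open>u\<close> is obtained for \<open>V = vector_fields (formal_smooth A)\<close>.
\<close>

type_synonym ('b, 'r, 'h) conn = "('b, 'r) vfield \<Rightarrow> ('b \<Rightarrow> 'h) \<Rightarrow> ('b \<Rightarrow> 'h)"

definition connection ::
  "('b::topological_space, 'r::comm_ring_1) sheaf \<Rightarrow> ('b, 'r) vfield set \<Rightarrow>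
     ('b, 'r, 'h::ab_group_add) vbundle \<Rightarrow> ('b, 'r, 'h) conn \<Rightarrow> bool" where
  "connection \<O> V H nab \<longleftrightarrow>
     (\<forall>Z\<in>V. \<forall>s \<in> sections \<O> H. nab Z s \<in> sections \<O> H) \<and>
     (\<forall>Z\<in>V. \<forall>Z'\<in>V. \<forall>s \<in> sections \<O> H.
        nab (\<lambda>g b. Z g b + Z' g b) s = (\<lambda>b. nab Z s b + nab Z' s b)) \<and>
     (\<forall>Z\<in>V. \<forall>s \<in> sections \<O> H. \<forall>f. \<O> UNIV f \<longrightarrow>
        nab (\<lambda>g b. f b * Z g b) s = (\<lambda>b. smul H (f b) (nab Z s b))) \<and>
     (\<forall>Z\<in>V. \<forall>s \<in> sections \<O> H. \<forall>t \<in> sections \<O> H.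
        nab Z (\<lambda>b. s b + t b) = (\<lambda>b. nab Z s b + nab Z t b)) \<and>
     (\<forall>Z\<in>V. \<forall>s \<in> sections \<O> H. \<forall>f. \<O> UNIV f \<longrightarrow>
        nab Z (\<lambda>b. smul H (f b) (s b)) = (\<lambda>b. smul H (Z f b) (s b) + smul H (f b) (nab Z s b)))"

definition flat_connection ::
  "('b::topological_space, 'r::comm_ring_1) sheaf \<Rightarrow> ('b, 'r) vfield set \<Rightarrow>
     ('b, 'r, 'h::ab_group_add) vbundle \<Rightarrow> ('b, 'r, 'h) conn \<Rightarrow> bool" where
  "flat_connection \<O> V H nab \<longleftrightarrow> connection \<O> V H nab \<and>
     (\<forall>Z\<in>V. \<forall>W\<in>V. \<forall>s \<in> sections \<O> H. \<forall>b.
        nab Z (nab W s) b - nab W (nab Z s) b - nab (bracket Z W) s b = 0)"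

section \<open>Legendre bundles\<close>

record ('b, 'r, 'h, 'p) legendre =
  hbundle :: "('b, 'r, 'h) vbundle"
  hplus :: "('b, 'r, 'h) vbundle"
  hminus :: "('b, 'r, 'h) vbundle"
  tau_plus :: "'b \<Rightarrow> 'h \<Rightarrow> ('b, 'r) tvec"
  tau_minus :: "'b \<Rightarrow> 'h \<Rightarrow> ('b, 'r) tcovec"
  pairing :: "'b \<Rightarrow> 'h \<Rightarrow> 'h \<Rightarrow> 'r"
  nabla_plus :: "('b, 'r, 'h) conn"
  nabla_minus :: "('b, 'r, 'h) conn"
  potential :: "'b \<Rightarrow> 'p"

definition legendre_splitting ::
  "('b::topological_space, 'r::comm_ring_1) sheaf \<Rightarrow>
     ('b, 'r, 'h::ab_group_add) vbundle \<Rightarrow> ('b, 'r, 'h) vbundle \<Rightarrow> ('b, 'r, 'h) vbundle \<Rightarrow>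
     ('b \<Rightarrow> 'h \<Rightarrow> ('b, 'r) tvec) \<Rightarrow> ('b \<Rightarrow> 'h \<Rightarrow> ('b, 'r) tcovec) \<Rightarrow> bool" where
  "legendre_splitting \<O> H P M \<tau>p \<tau>m \<longleftrightarrow>
     vector_bundle \<O> H \<and> vector_bundle \<O> P \<and> vector_bundle \<O> M \<and>
     direct_sum_bundle \<O> H P M \<and> tangent_iso \<O> P \<tau>p \<and> cotangent_iso \<O> M \<tau>m"

definition legendre_pairing ::
  "('b::topological_space, 'r::comm_ring_1) sheaf \<Rightarrow> ('b, 'r, 'h::ab_group_add, 'p) legendre \<Rightarrow> bool"
  where
  "legendre_pairing \<O> L \<longleftrightarrow>
     bilinear_form \<O> (hbundle L) (pairing L) \<and> nondegenerate (hbundle L) (pairing L) \<and>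
     (\<forall>b. \<forall>x \<in> fibre (hbundle L) b. \<forall>y \<in> fibre (hbundle L) b. pairing L b x y = pairing L b y x) \<and>
     (\<forall>b. \<forall>x \<in> fibre (hplus L) b. \<forall>y \<in> fibre (hplus L) b. pairing L b x y = 0) \<and>
     (\<forall>b. \<forall>x \<in> fibre (hminus L) b. \<forall>y \<in> fibre (hminus L) b. pairing L b x y = 0) \<and>
     (\<forall>b. \<forall>x \<in> fibre (hplus L) b. \<forall>\<alpha> \<in> fibre (hminus L) b.
        pairing L b x \<alpha> = tau_minus L b \<alpha> (tau_plus L b x))"

definition dual_connections ::
  "('b::topological_space, 'r::comm_ring_1) sheaf \<Rightarrow> ('b, 'r) vfield set \<Rightarrow>
     ('b, 'r, 'h::ab_group_add, 'p) legendre \<Rightarrow> bool" where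
  "dual_connections \<O> V L \<longleftrightarrow>
     (\<forall>Z\<in>V. \<forall>s \<in> sections \<O> (hplus L). \<forall>\<alpha> \<in> sections \<O> (hminus L). \<forall>b.
        Z (\<lambda>x. pairing L x (s x) (\<alpha> x)) b =
          pairing L b (nabla_plus L Z s b) (\<alpha> b) + pairing L b (s b) (nabla_minus L Z \<alpha> b))"

definition as_vector_field :: "('b, 'r, 'h, 'p) legendre \<Rightarrow> ('b \<Rightarrow> 'h) \<Rightarrow> ('b, 'r) vfield" where
  "as_vector_field L s = (\<lambda>f b. tau_plus L b (s b) f)"

definition torsion_free ::
  "('b::topological_space, 'r::comm_ring_1) sheaf \<Rightarrow> ('b, 'r, 'h::ab_group_add, 'p) legendre \<Rightarrow> bool"
  where
  "torsion_free \<O> L \<longleftrightarrow>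
     (\<forall>s \<in> sections \<O> (hplus L). \<forall>t \<in> sections \<O> (hplus L). \<forall>f b. \<O> UNIV f \<longrightarrow>
        as_vector_field L (nabla_plus L (as_vector_field L s) t) f b
        - as_vector_field L (nabla_plus L (as_vector_field L t) s) f b
        = bracket (as_vector_field L s) (as_vector_field L t) f b)"

text \<open>
  Conditions (1)--(3) of a Legendre bundle with connections in the directions \<open>V\<close>. For the ring
  \<open>k[[u]]\<close>, torsion-freeness only involves directions along \<open>B\<close>, i.e. fixed \<open>u\<close>.
\<close>

definition legendre_structure ::
  "('b::topological_space, 'r::comm_ring_1) sheaf \<Rightarrow> ('b, 'r) vfield set \<Rightarrow>
     ('b, 'r, 'h::ab_group_add, 'p) legendre \<Rightarrow> bool" where
  "legendre_structure \<O> V L \<longleftrightarrow>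
     legendre_splitting \<O> (hbundle L) (hplus L) (hminus L) (tau_plus L) (tau_minus L) \<and>
     legendre_pairing \<O> L \<and>
     flat_connection \<O> V (hplus L) (nabla_plus L) \<and>
     flat_connection \<O> V (hminus L) (nabla_minus L) \<and>
     dual_connections \<O> V L \<and> torsion_free \<O> L"

definition chart_deriv ::
  "'b set \<Rightarrow> ('b \<Rightarrow> 'e::euclidean_space) \<Rightarrow> 'e \<Rightarrow> ('b \<Rightarrow> 'v::real_normed_vector) \<Rightarrow> ('b \<Rightarrow> 'v)" where
  "chart_deriv U \<phi> v f = (\<lambda>b. frechet_derivative (f \<circ> inv_into U \<phi>) (at (\<phi> b)) v)"

text \<open>
  Coordinates with \<open>\<nabla>\<^sup>+\<close>-parallel coordinate fields. As \<open>nabla_plus\<close> acts on global sections,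
  \<open>\<partial>\<^sub>i\<close> is represented by global sections that agree with it on an open subset; by means of
  bump functions there is one near every point.
\<close>

definition flat_chart ::
  "('b::topological_space, 'e::euclidean_space) atlas \<Rightarrow>
     ('b, 'k::real_normed_field, 'h::ab_group_add, 'p) legendre \<Rightarrow> 'b set \<Rightarrow> ('b \<Rightarrow> 'e) \<Rightarrow> bool" where
  "flat_chart A L U \<phi> \<longleftrightarrow> smooth_chart A U \<phi> \<and>
     (\<forall>i\<in>Basis. \<forall>W s. open W \<longrightarrow> W \<subseteq> U \<longrightarrow> s \<in> sections (smooth A) (hplus L) \<longrightarrow>
        (\<forall>b\<in>W. \<forall>f. smooth A UNIV f \<longrightarrow> as_vector_field L s f b = chart_deriv U \<phi> i f b) \<longrightarrow>
        (\<forall>Z \<in> vector_fields (smooth A). \<forall>b\<in>W. nabla_plus L Z s b = 0))"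

definition positive_hessian ::
  "'b set \<Rightarrow> ('b \<Rightarrow> 'e::euclidean_space) \<Rightarrow> ('b \<Rightarrow> real) \<Rightarrow> 'b \<Rightarrow> bool" where
  "positive_hessian U \<phi> \<psi> b \<longleftrightarrow>
     (\<forall>\<xi>. \<xi> \<noteq> 0 \<longrightarrow>
        (\<Sum>i\<in>Basis. \<Sum>j\<in>Basis.
           (\<xi> \<bullet> i) * (\<xi> \<bullet> j) * chart_deriv U \<phi> i (chart_deriv U \<phi> j \<psi>) b) > 0)"

text \<open>
  Positivity does not depend on the flat chart, since changes of flat coordinates are affine.
\<close>

definition strictly_convex ::
  "('b::topological_space, 'e::euclidean_space) atlas \<Rightarrow>
     ('b, 'k::real_normed_field, 'h::ab_group_add, real) legendre \<Rightarrow> bool" where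
  "strictly_convex A L \<longleftrightarrow>
     (\<forall>p. \<exists>U \<phi>. flat_chart A L U \<phi> \<and> p \<in> U \<and> (\<forall>b\<in>U. positive_hessian U \<phi> (potential L) b))"

text \<open>For \<open>'k = real\<close> this is a classical Legendre bundle; in general the bundle is tensored with \<open>k\<close>.\<close>

definition classical_legendre ::
  "('b::topological_space, 'e::euclidean_space) atlas \<Rightarrow>
     ('b, 'k::real_normed_field, 'h::ab_group_add, real) legendre \<Rightarrow> bool" where
  "classical_legendre A L \<longleftrightarrow>
     legendre_structure (smooth A) (vector_fields (smooth A)) L \<and>
     smooth A UNIV (potential L) \<and> strictly_convex A L"

section \<open>Pullback to \<open>B \<times> D\<close> and restriction to \<open>u = 0\<close>\<close>

definition fps_smul :: "('k \<Rightarrow> 'h \<Rightarrow> 'h::ab_group_add) \<Rightarrow> 'k fps \<Rightarrow> 'h fps \<Rightarrow> 'h fps" where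
  "fps_smul s f x = Abs_fps (\<lambda>n. \<Sum>i\<le>n. s (f $ i) (x $ (n - i)))"

definition pull_bundle ::
  "('b, 'k::real_normed_field, 'h::ab_group_add) vbundle \<Rightarrow> ('b, 'k fps, 'h fps) vbundle" where
  "pull_bundle H =
     \<lparr>smul = fps_smul (smul H),
      fibre = (\<lambda>b. {x. \<forall>n. x $ n \<in> fibre H b}),
      frames = {(U, r, \<lambda>i b. fps_const (e i b)) | U r e. (U, r, e) \<in> frames H}\<rparr>"

text \<open>
  A power series of vectors acts on formal functions by \<open>(\<Sum> u\<^sup>i D\<^sub>i) (\<Sum> u\<^sup>j f\<^sub>j) = \<Sum> u\<^bsup>i+j\<^esup> D\<^sub>i f\<^sub>j\<close>,
  and \<open>pull_tau\<^sub>\<plusminus>\<close> extend \<open>H\<^sup>+ \<cong> TB\<close>, \<open>H\<^sup>- \<cong> T\<^sup>*B\<close> linearly over \<open>k[[u]]\<close>.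
\<close>

definition pull_tau_plus ::
  "('b::topological_space, 'e::euclidean_space) atlas \<Rightarrow>
     ('b \<Rightarrow> 'h \<Rightarrow> ('b, 'k::real_normed_field) tvec) \<Rightarrow> 'b \<Rightarrow> 'h fps \<Rightarrow> ('b, 'k fps) tvec" where
  "pull_tau_plus A \<tau> b x = (\<lambda>f.
     if formal_smooth A UNIV f
     then Abs_fps (\<lambda>n. \<Sum>i\<le>n. \<tau> b (x $ i) (\<lambda>y. f y $ (n - i))) else 0)"

definition vec_coeff ::
  "('b::topological_space, 'e::euclidean_space) atlas \<Rightarrow>
     ('b, 'k::real_normed_field fps) tvec \<Rightarrow> nat \<Rightarrow> ('b, 'k) tvec" where
  "vec_coeff A D j = (\<lambda>f. if smooth A UNIV f then D (\<lambda>y. fps_const (f y)) $ j else 0)"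

definition pull_tau_minus ::
  "('b::topological_space, 'e::euclidean_space) atlas \<Rightarrow>
     ('b \<Rightarrow> 'h \<Rightarrow> ('b, 'k::real_normed_field) tcovec) \<Rightarrow> 'b \<Rightarrow> 'h fps \<Rightarrow> ('b, 'k fps) tcovec" where
  "pull_tau_minus A \<tau> b x = (\<lambda>D.
     if D \<in> tangent (formal_smooth A) b
     then Abs_fps (\<lambda>n. \<Sum>i\<le>n. \<tau> b (x $ i) (vec_coeff A D (n - i))) else 0)"

definition pull_vec ::
  "('b::topological_space, 'e::euclidean_space) atlas \<Rightarrow>
     ('b, 'k::real_normed_field) tvec \<Rightarrow> ('b, 'k fps) tvec" where
  "pull_vec A D = (\<lambda>f. if formal_smooth A UNIV f then Abs_fps (\<lambda>n. D (\<lambda>y. f y $ n)) else 0)"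

definition pull_vfield ::
  "('b::topological_space, 'e::euclidean_space) atlas \<Rightarrow>
     ('b, 'k::real_normed_field) vfield \<Rightarrow> ('b, 'k fps) vfield" where
  "pull_vfield A Z = (\<lambda>f b. pull_vec A (\<lambda>g. Z g b) f)"

definition vfield_at_0 ::
  "('b::topological_space, 'e::euclidean_space) atlas \<Rightarrow>
     ('b, 'k::real_normed_field fps) vfield \<Rightarrow> ('b, 'k) vfield" where
  "vfield_at_0 A Z = (\<lambda>f b. vec_coeff A (\<lambda>g. Z g b) 0 f)"

definition bundle_at_0 ::
  "('b, 'k::real_normed_field fps, 'h::ab_group_add fps) vbundle \<Rightarrow> ('b, 'k, 'h) vbundle" where
  "bundle_at_0 H =
     \<lparr>smul = (\<lambda>c x. smul H (fps_const c) (fps_const x) $ 0),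
      fibre = (\<lambda>b. (\<lambda>x. x $ 0) ` fibre H b),
      frames = {(U, r, \<lambda>i b. e i b $ 0) | U r e. (U, r, e) \<in> frames H}\<rparr>"

definition conn_at_0 ::
  "('b::topological_space, 'e::euclidean_space) atlas \<Rightarrow>
     ('b, 'k::real_normed_field fps, 'h::ab_group_add fps) conn \<Rightarrow> ('b, 'k, 'h) conn" where
  "conn_at_0 A nab = (\<lambda>Z s b. nab (pull_vfield A Z) (\<lambda>y. fps_const (s y)) b $ 0)"

definition legendre_at_0 ::
  "('b::topological_space, 'e::euclidean_space) atlas \<Rightarrow>
     ('b, 'k::real_normed_field fps, 'h::ab_group_add fps, real fps) legendre \<Rightarrow>
     ('b, 'k, 'h, real) legendre" where
  "legendre_at_0 A L =
     \<lparr>hbundle = bundle_at_0 (hbundle L),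
      hplus = bundle_at_0 (hplus L),
      hminus = bundle_at_0 (hminus L),
      tau_plus = (\<lambda>b x. vec_coeff A (tau_plus L b (fps_const x)) 0),
      tau_minus = (\<lambda>b x D.
        if D \<in> tangent (smooth A) b then tau_minus L b (fps_const x) (pull_vec A D) $ 0 else 0),
      pairing = (\<lambda>b x y. pairing L b (fps_const x) (fps_const y) $ 0),
      nabla_plus = conn_at_0 A (nabla_plus L),
      nabla_minus = conn_at_0 A (nabla_minus L),
      potential = (\<lambda>b. potential L b $ 0)\<rparr>"

text \<open>
  That the isomorphisms with \<open>\<pi>\<^sub>B\<^sup>* TB\<close> and \<open>\<pi>\<^sub>B\<^sup>* T\<^sup>*B\<close> are independent of \<open>u\<close> is expressed by
  taking the splitting and the isomorphisms to be pulled back from \<open>B\<close>.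
\<close>

definition legendre_family ::
  "('b::topological_space, 'e::euclidean_space) atlas \<Rightarrow>
     ('b, 'k::real_normed_field fps, 'h::ab_group_add fps, real fps) legendre \<Rightarrow> bool" where
  "legendre_family A L \<longleftrightarrow>
     (\<exists>H P M \<tau>p \<tau>m. legendre_splitting (smooth A) H P M \<tau>p \<tau>m \<and>
        hbundle L = pull_bundle H \<and> hplus L = pull_bundle P \<and> hminus L = pull_bundle M \<and>
        (\<forall>b. \<forall>x \<in> fibre (hplus L) b. tau_plus L b x = pull_tau_plus A \<tau>p b x) \<and>
        (\<forall>b. \<forall>x \<in> fibre (hminus L) b. tau_minus L b x = pull_tau_minus A \<tau>m b x)) \<and>
     legendre_structure (formal_smooth A) (total_vector_fields A) L \<and>
     formal_smooth A UNIV (potential L) \<and>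
     strictly_convex A (legendre_at_0 A L)"

section \<open>Para-Kaehler vector bundles\<close>

definition bundle_endomorphism ::
  "('b::topological_space, 'r::comm_ring_1) sheaf \<Rightarrow> ('b, 'r, 'h::ab_group_add) vbundle \<Rightarrow>
     ('b \<Rightarrow> 'h \<Rightarrow> 'h) \<Rightarrow> bool" where
  "bundle_endomorphism \<O> H J \<longleftrightarrow>
     (\<forall>b. J b ` fibre H b \<subseteq> fibre H b \<and> linear_on (smul H) (fibre H b) (smul H) (J b)) \<and>
     (\<forall>W s. open W \<longrightarrow> section_on \<O> H W s \<longrightarrow> section_on \<O> H W (\<lambda>b. J b (s b)))"

definition local_frame ::
  "('b::topological_space, 'r::comm_ring_1) sheaf \<Rightarrow> ('b, 'r, 'h::ab_group_add) vbundle \<Rightarrow>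
     ('b \<Rightarrow> 'h set) \<Rightarrow> 'b set \<Rightarrow> nat \<Rightarrow> (nat \<Rightarrow> 'b \<Rightarrow> 'h) \<Rightarrow> bool" where
  "local_frame \<O> H F U r e \<longleftrightarrow>
     (\<forall>i<r. section_on \<O> H U (e i)) \<and> (\<forall>b\<in>U. is_basis (smul H) (F b) r (\<lambda>i. e i b))"

definition equal_rank ::
  "('b::topological_space, 'r::comm_ring_1) sheaf \<Rightarrow> ('b, 'r, 'h::ab_group_add) vbundle \<Rightarrow>
     ('b \<Rightarrow> 'h set) \<Rightarrow> ('b \<Rightarrow> 'h set) \<Rightarrow> bool" where
  "equal_rank \<O> H F G \<longleftrightarrow>
     (\<forall>p. \<exists>U r e f. open U \<and> p \<in> U \<and> local_frame \<O> H F U r e \<and> local_frame \<O> H G U r f)"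

definition para_kaehler ::
  "('b::topological_space, 'r::comm_ring_1) sheaf \<Rightarrow> ('b, 'r, 'h::ab_group_add) vbundle \<Rightarrow>
     ('b \<Rightarrow> 'h \<Rightarrow> 'h) \<Rightarrow> ('b \<Rightarrow> 'h \<Rightarrow> 'h \<Rightarrow> 'r) \<Rightarrow> ('b, 'r, 'h) conn \<Rightarrow> bool" where
  "para_kaehler \<O> H J \<omega> nab \<longleftrightarrow>
     vector_bundle \<O> H \<and>
     bundle_endomorphism \<O> H J \<and>
     (\<forall>b. \<forall>x \<in> fibre H b. J b (J b x) = x) \<and>
     equal_rank \<O> H (\<lambda>b. {x \<in> fibre H b. J b x = x}) (\<lambda>b. {x \<in> fibre H b. J b x = - x}) \<and>
     bilinear_form \<O> H \<omega> \<and> nondegenerate H \<omega> \<and>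
     (\<forall>b. \<forall>x \<in> fibre H b. \<forall>y \<in> fibre H b. \<omega> b x y = - \<omega> b y x) \<and>
     (\<forall>b. \<forall>x \<in> fibre H b. \<forall>y \<in> fibre H b. \<omega> b (J b x) (J b y) = - \<omega> b x y) \<and>
     flat_connection \<O> (vector_fields \<O>) H nab \<and>
     (\<forall>Z \<in> vector_fields \<O>. \<forall>s \<in> sections \<O> H. \<forall>b.
        nab Z (\<lambda>y. J y (s y)) b = J b (nab Z s b)) \<and>
     (\<forall>Z \<in> vector_fields \<O>. \<forall>s \<in> sections \<O> H. \<forall>t \<in> sections \<O> H. \<forall>b.
        Z (\<lambda>y. \<omega> y (s y) (t y)) b = \<omega> b (nab Z s b) (t b) + \<omega> b (s b) (nab Z t b))"

definition formal_deformation ::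
  "('b::topological_space, 'e::euclidean_space) atlas \<Rightarrow>
     ('b, 'k::real_normed_field, 'h::ab_group_add) vbundle \<Rightarrow>
     ('b \<Rightarrow> 'h \<Rightarrow> 'h) \<Rightarrow> ('b \<Rightarrow> 'h \<Rightarrow> 'h \<Rightarrow> 'k) \<Rightarrow> ('b, 'k, 'h) conn \<Rightarrow>
     ('b, 'k fps, 'h fps) vbundle \<Rightarrow>
     ('b \<Rightarrow> 'h fps \<Rightarrow> 'h fps) \<Rightarrow> ('b \<Rightarrow> 'h fps \<Rightarrow> 'h fps \<Rightarrow> 'k fps) \<Rightarrow> ('b, 'k fps, 'h fps) conn \<Rightarrow>
     bool" where
  "formal_deformation A H0 J0 \<omega>0 nab0 H J \<omega> nab \<longleftrightarrow>
     para_kaehler (smooth A) H0 J0 \<omega>0 nab0 \<and>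
     para_kaehler (formal_smooth A) H J \<omega> nab \<and>
     H = pull_bundle H0 \<and>
     (\<forall>b. \<forall>x \<in> fibre H b. J b x $ 0 = J0 b (x $ 0)) \<and>
     (\<forall>b. \<forall>x \<in> fibre H b. \<forall>y \<in> fibre H b. \<omega> b x y $ 0 = \<omega>0 b (x $ 0) (y $ 0)) \<and>
     (\<forall>Z \<in> vector_fields (formal_smooth A). \<forall>s \<in> sections (formal_smooth A) H. \<forall>b.
        nab Z s b $ 0 = nab0 (vfield_at_0 A Z) (\<lambda>y. s y $ 0) b)"

section \<open>The para-Kaehler data induced by a Legendre bundle\<close>

definition proj_plus :: "('b, 'r, 'h::ab_group_add, 'p) legendre \<Rightarrow> 'b \<Rightarrow> 'h \<Rightarrow> 'h" where
  "proj_plus L b x = (THE p. p \<in> fibre (hplus L) b \<and> x - p \<in> fibre (hminus L) b)"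

definition proj_minus :: "('b, 'r, 'h::ab_group_add, 'p) legendre \<Rightarrow> 'b \<Rightarrow> 'h \<Rightarrow> 'h" where
  "proj_minus L b x = x - proj_plus L b x"

definition induced_J :: "('b, 'r, 'h::ab_group_add, 'p) legendre \<Rightarrow> 'b \<Rightarrow> 'h \<Rightarrow> 'h" where
  "induced_J L b x = proj_plus L b x - proj_minus L b x"

definition induced_omega :: "('b, 'r, 'h::ab_group_add, 'p) legendre \<Rightarrow> 'b \<Rightarrow> 'h \<Rightarrow> 'h \<Rightarrow> 'r" where
  "induced_omega L b x y = pairing L b (induced_J L b x) y"

definition induced_nabla :: "('b, 'r, 'h::ab_group_add, 'p) legendre \<Rightarrow> ('b, 'r, 'h) conn" where
  "induced_nabla L Z s b =
     nabla_plus L Z (\<lambda>y. proj_plus L y (s y)) b + nabla_minus L Z (\<lambda>y. proj_minus L y (s y)) b"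

end

theory Submission
  imports Defs
begin

text \<open>
  A Legendre bundle over any function ring induces a para-Kaehler structure: everything is linear
  algebra along the splitting \<open>H = H\<^sup>+ \<oplus> H\<^sup>-\<close>, both summands being isotropic. Only the equality of
  ranks is not formal; it is read off over the field \<open>k\<close>, where non-degeneracy of the pairing makes
  \<open>H\<^sup>-\<close> inject into the dual of \<open>H\<^sup>+\<close> and conversely, and frames over \<open>k[[u]]\<close> are constant
  extensions of frames over \<open>k\<close>.

  At \<open>u = 0\<close> all data are reductions of formal data applied to constant extensions. The key point is
  that a formal section or vector field differs from the constant extension of its reduction by a
  multiple of \<open>u\<close>, and that connections along \<open>B\<close> are \<open>k[[u]]\<close>-linear, so that the reduction of
  \<open>\<nabla>\<^bsub>Z\<^esub> s\<close> depends only on the reductions of \<open>Z\<close> and \<open>s\<close>.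
\<close>

text \<open>Three obstacles shape the argument. Equality of ranks for fixed \<open>u\<close> is
  decided over the field \<open>k\<close>, so the reduction at \<open>u = 0\<close> must be known to
  be a Legendre structure before the formal statement can be completed. A formal vector field is an
  operator on functions, not a list of coefficient fields: division by \<open>u\<close> has to be
  carried out on values, and the quotient must be shown to be a derivation again before linearity of
  a connection applies to it. Since a connection sees its arguments as bare functions, vector fields
  have to be matched also at arguments outside the function ring. Finally, injectivity of a pairing
  over \<open>k[[u]]\<close> does not survive reduction, as multiplication by \<open>u\<close>
  shows; the surjectivity built into \<open>nondegenerate\<close> is what carries non-degeneracy to
  \<open>u = 0\<close>.\<close>

section \<open>Calculus of finitely often differentiable functions on open sets\<close>

lemma Ck_on_mono: "Ck_on n S f \<Longrightarrow> T \<subseteq> S \<Longrightarrow> Ck_on n T f"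
  by (induction n arbitrary: f)
    (auto intro: continuous_on_subset differentiable_on_subset)

text \<open>Openness turns agreement on \<open>S\<close> into agreement of germs, and
  \<open>frechet_derivative\<close> at a point, taken in the whole space, only sees the
  germ.\<close>

lemma Ck_on_cong:
  assumes "open S" "\<And>x. x \<in> S \<Longrightarrow> f x = g x" "Ck_on n S f"
  shows "Ck_on n S g"
  using assms(2,3)
proof (induction n arbitrary: f g)
  case 0
  then show ?case by (metis Ck_on.simps(1) continuous_on_cong)
next
  case (Suc n)
  have der: "frechet_derivative f (at x) = frechet_derivative g (at x)" if "x \<in> S" for x
  proof -
    \<comment> \<open>\<open>frechet_derivative\<close> is a choice among all derivatives, so the
      two choices agree once the predicates coincide for every \<open>D\<close>.\<close>
    have "(f has_derivative D) (at x) \<longleftrightarrow> (g has_derivative D) (at x)" for D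
      using has_derivative_transform_within_open[of f D x UNIV S g]
        has_derivative_transform_within_open[of g D x UNIV S f] assms(1) that Suc.prems(1)
      by (metis (no_types, lifting))
    then show ?thesis by (simp add: frechet_derivative_def)
  qed
  have "g differentiable_on S"
    using Suc.prems unfolding Ck_on.simps differentiable_on_def differentiable_def
    by (metis has_derivative_transform)
  moreover have "Ck_on n S (\<lambda>x. frechet_derivative g (at x) v)" for v
    by (rule Suc.IH[of "\<lambda>x. frechet_derivative f (at x) v"]) (use der Suc.prems(2) in auto)
  ultimately show ?case by simp
qed

lemma Ck_on_SucD: "Ck_on (Suc n) S f \<Longrightarrow> Ck_on n S f"
  by (induction n arbitrary: f) (auto intro: differentiable_imp_continuous_on)

lemma Ck_on_const: "Ck_on n S (\<lambda>_. c)"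
proof (induction n arbitrary: c)
  case (Suc n)
  then show ?case by simp
qed simp

lemma Ck_on_add:
  assumes "open S"
  shows "Ck_on n S f \<Longrightarrow> Ck_on n S g \<Longrightarrow> Ck_on n S (\<lambda>x. f x + g x)"
proof (induction n arbitrary: f g)
  case (Suc n)
  have df: "(f has_derivative frechet_derivative f (at x)) (at x)"
    "(g has_derivative frechet_derivative g (at x)) (at x)" if "x \<in> S" for x
    using Suc.prems assms that
    by (auto simp: differentiable_on_eq_differentiable_at frechet_derivative_works)
  have "frechet_derivative (\<lambda>x. f x + g x) (at x) v
      = frechet_derivative f (at x) v + frechet_derivative g (at x) v" if "x \<in> S" for x v
    using frechet_derivative_at[OF has_derivative_add[OF df[OF that]]] by (rule fun_cong[symmetric])
  moreover have "Ck_on n S (\<lambda>x. frechet_derivative f (at x) v + frechet_derivative g (at x) v)" for v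
    using Suc.prems by (auto intro!: Suc.IH)
  ultimately have "Ck_on n S (\<lambda>x. frechet_derivative (\<lambda>x. f x + g x) (at x) v)" for v
    using Ck_on_cong[OF assms] by (metis (no_types, lifting))
  then show ?case using Suc.prems by (simp add: differentiable_on_add)
qed (simp add: continuous_on_add)

text \<open>The Leibniz rule leaves one factor undifferentiated in each term; the induction
  hypothesis wants that factor at order \<open>n\<close>, which is where \<open>Ck_on_SucD\<close>
  enters.\<close>

lemma Ck_on_mult:
  fixes f g :: "'e::euclidean_space \<Rightarrow> 'a::real_normed_algebra"
  assumes "open S"
  shows "Ck_on n S f \<Longrightarrow> Ck_on n S g \<Longrightarrow> Ck_on n S (\<lambda>x. f x * g x)"
proof (induction n arbitrary: f g)
  case (Suc n)
  have df: "(f has_derivative frechet_derivative f (at x)) (at x)"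
    "(g has_derivative frechet_derivative g (at x)) (at x)" if "x \<in> S" for x
    using Suc.prems assms that
    by (auto simp: differentiable_on_eq_differentiable_at frechet_derivative_works)
  have "frechet_derivative (\<lambda>x. f x * g x) (at x) v
      = f x * frechet_derivative g (at x) v + frechet_derivative f (at x) v * g x" if "x \<in> S" for x v
    using frechet_derivative_at[OF has_derivative_mult[OF df[OF that]]] by (rule fun_cong[symmetric])
  moreover have "Ck_on n S (\<lambda>x. f x * frechet_derivative g (at x) v
      + frechet_derivative f (at x) v * g x)" for v
    using Suc.prems Suc.prems[THEN Ck_on_SucD] by (auto intro!: Suc.IH Ck_on_add[OF assms])
  ultimately have "Ck_on n S (\<lambda>x. frechet_derivative (\<lambda>x. f x * g x) (at x) v)" for v
    using Ck_on_cong[OF assms] by (metis (no_types, lifting))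
  then show ?case using Suc.prems by (simp add: differentiable_on_mult)
qed (simp add: continuous_on_mult)

section \<open>Rings of functions, smooth or formal\<close>

text \<open>What the bundle argument asks of a function ring; \<open>smooth A\<close> and
  \<open>formal_smooth A\<close> are the two models. The rule \<open>cong\<close> is there because
  functions are total while only their values on \<open>W\<close> matter.\<close>

locale function_sheaf =
  fixes \<O> :: "('b::topological_space, 'r::comm_ring_1) sheaf"
  assumes const: "\<O> W (\<lambda>_. c)"
    and add: "open W \<Longrightarrow> \<O> W f \<Longrightarrow> \<O> W g \<Longrightarrow> \<O> W (\<lambda>x. f x + g x)"
    and mult: "open W \<Longrightarrow> \<O> W f \<Longrightarrow> \<O> W g \<Longrightarrow> \<O> W (\<lambda>x. f x * g x)"
    and restrict: "\<O> W f \<Longrightarrow> W' \<subseteq> W \<Longrightarrow> \<O> W' f"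
    and cong: "open W \<Longrightarrow> (\<And>b. b \<in> W \<Longrightarrow> f b = g b) \<Longrightarrow> \<O> W f \<Longrightarrow> \<O> W g"
begin

lemma cmult: "open W \<Longrightarrow> \<O> W f \<Longrightarrow> \<O> W (\<lambda>x. c * f x)"
  by (rule mult[OF _ const])

lemma uminus: "open W \<Longrightarrow> \<O> W f \<Longrightarrow> \<O> W (\<lambda>x. - f x)"
  using cmult[of W f "- 1"] by simp

lemma diff: "open W \<Longrightarrow> \<O> W f \<Longrightarrow> \<O> W g \<Longrightarrow> \<O> W (\<lambda>x. f x - g x)"
  using add[of W f "\<lambda>x. - g x"] uminus[of W g] by simp

lemma sum: "open W \<Longrightarrow> (\<And>i. i \<in> I \<Longrightarrow> \<O> W (f i)) \<Longrightarrow> \<O> W (\<lambda>x. \<Sum>i\<in>I. f i x)"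
  by (induction I rule: infinite_finite_induct) (auto intro: const add)

end

lemma function_sheaf_smooth:
  fixes A :: "('b::{t2_space, second_countable_topology}, 'e::euclidean_space) atlas"
  assumes "smooth_atlas A"
  shows "function_sheaf (smooth A :: ('b, 'k::real_normed_field) sheaf)"
proof -
  have chart: "open U" "open (\<phi> ` U)" "homeomorphism U (\<phi> ` U) \<phi> (inv_into U \<phi>)"
    if "(U, \<phi>) \<in> A" for U \<phi>
    using assms that by (auto simp: smooth_atlas_def smooth_chart_def)
  \<comment> \<open>The image of \<open>U \<inter> W\<close> is open in the chart image, which is
    open itself; this brings the calculus on open sets into play.\<close>
  have op: "open (\<phi> ` (U \<inter> W))" if "(U, \<phi>) \<in> A" "open W" for U \<phi> W
  proof -
    note * = chart[OF that(1)]
    have "openin (top_of_set (\<phi> ` U)) (\<phi> ` (U \<inter> W))"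
      using homeomorphism_imp_open_map[OF *(3), of "U \<inter> W"] that by (simp add: openin_open_Int)
    then show ?thesis using *(2) by (simp add: openin_open_eq)
  qed
  show ?thesis
  proof
    fix W and c :: 'k
    show "smooth A W (\<lambda>_. c)"
      by (auto simp: smooth_def Cinf_on_def o_def Ck_on_const)
  next
    fix W and f g :: "'b \<Rightarrow> 'k"
    assume *: "open W" "smooth A W f" "smooth A W g"
    show "smooth A W (\<lambda>x. f x + g x)" "smooth A W (\<lambda>x. f x * g x)"
      using * Ck_on_add[OF op] Ck_on_mult[OF op]
      by (fastforce simp: smooth_def Cinf_on_def o_def)+
  next
    fix W W' and f :: "'b \<Rightarrow> 'k"
    assume "smooth A W f" "W' \<subseteq> W"
    then show "smooth A W' f"
      by (auto simp: smooth_def Cinf_on_def intro!: Ck_on_mono[of _ "\<phi> ` (U \<inter> W)" _ "\<phi> ` (U \<inter> W')" for \<phi> U])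
  next
    fix W and f g :: "'b \<Rightarrow> 'k"
    assume W: "open W" and eq: "\<And>b. b \<in> W \<Longrightarrow> f b = g b" and f: "smooth A W f"
    have "Cinf_on (\<phi> ` (U \<inter> W)) (g \<circ> inv_into U \<phi>)" if U: "(U, \<phi>) \<in> A" for U \<phi>
    proof -
      have "Ck_on n (\<phi> ` (U \<inter> W)) (f \<circ> inv_into U \<phi>)" for n
        using f U by (auto simp: smooth_def Cinf_on_def)
      moreover have "(f \<circ> inv_into U \<phi>) x = (g \<circ> inv_into U \<phi>) x" if "x \<in> \<phi> ` (U \<inter> W)" for x
        using that eq homeomorphism_apply1[OF chart(3)[OF U]] by auto
      ultimately show ?thesis
        unfolding Cinf_on_def using Ck_on_cong[OF op[OF U W]] by blast
    qed
    then show "smooth A W g" by (auto simp: smooth_def)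
  qed
qed

text \<open>Each coefficient of a product is a finite Cauchy sum of products, so every closure
  property passes from the coefficients to the series.\<close>

lemma function_sheaf_formal_smooth:
  fixes A :: "('b::{t2_space, second_countable_topology}, 'e::euclidean_space) atlas"
  assumes "smooth_atlas A"
  shows "function_sheaf (formal_smooth A :: ('b, 'k::real_normed_field fps) sheaf)"
proof -
  interpret function_sheaf "smooth A :: ('b, 'k) sheaf"
    by (rule function_sheaf_smooth[OF assms])
  show ?thesis
  proof
    fix W and f g :: "'b \<Rightarrow> 'k fps"
    assume W: "open W" and eq: "\<And>b. b \<in> W \<Longrightarrow> f b = g b" and f: "formal_smooth A W f"
    have "smooth A W (\<lambda>b. g b $ n)" for n
      by (rule cong[OF W, of "\<lambda>b. f b $ n"]) (use eq f in \<open>simp_all add: formal_smooth_def\<close>)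
    then show "formal_smooth A W g" by (simp add: formal_smooth_def)
  qed (auto simp: formal_smooth_def fps_mult_nth intro: const add restrict intro!: sum mult)
qed

section \<open>Rules for sections, connections and derivations\<close>

lemma sections_iff: "s \<in> sections \<O> H \<longleftrightarrow> section_on \<O> H UNIV s"
  by (simp add: sections_def)

lemma section_on_fibre: "section_on \<O> H W s \<Longrightarrow> b \<in> W \<Longrightarrow> s b \<in> fibre H b"
  by (simp add: section_on_def)

lemma sections_fibre: "s \<in> sections \<O> H \<Longrightarrow> s b \<in> fibre H b"
  by (simp add: sections_iff section_on_fibre)

lemma connectionD:
  assumes "connection \<O> V H nab" "Z \<in> V" "s \<in> sections \<O> H"
  shows "nab Z s \<in> sections \<O> H"
    and "Z' \<in> V \<Longrightarrow> nab (\<lambda>g b. Z g b + Z' g b) s = (\<lambda>b. nab Z s b + nab Z' s b)"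
    and "\<O> UNIV f \<Longrightarrow> nab (\<lambda>g b. f b * Z g b) s = (\<lambda>b. smul H (f b) (nab Z s b))"
    and "t \<in> sections \<O> H \<Longrightarrow> nab Z (\<lambda>b. s b + t b) = (\<lambda>b. nab Z s b + nab Z t b)"
    and "\<O> UNIV f \<Longrightarrow> nab Z (\<lambda>b. smul H (f b) (s b))
           = (\<lambda>b. smul H (Z f b) (s b) + smul H (f b) (nab Z s b))"
  using assms unfolding connection_def by blast+

lemma flat_connection_curvature:
  assumes "flat_connection \<O> V H nab" "Z \<in> V" "W \<in> V" "s \<in> sections \<O> H"
  shows "nab Z (nab W s) b - nab W (nab Z s) b - nab (bracket Z W) s b = 0"
  using assms by (auto simp: flat_connection_def)

text \<open>The passage to fixed \<open>u\<close>: the same operator, tested in fewer directions.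
  Every clause is universally quantified over \<open>V\<close>, and none asks \<open>V\<close> to be
  closed under sums or brackets.\<close>

lemma flat_connection_mono:
  "flat_connection \<O> V H nab \<Longrightarrow> V' \<subseteq> V \<Longrightarrow> flat_connection \<O> V' H nab"
  unfolding flat_connection_def connection_def subset_iff by (elim conjE, intro conjI) blast+

lemma tangentD:
  assumes "D \<in> tangent \<O> b"
  shows "\<not> \<O> UNIV f \<Longrightarrow> D f = 0"
    and "\<O> UNIV f \<Longrightarrow> \<O> UNIV g \<Longrightarrow> D (\<lambda>x. f x + g x) = D f + D g"
    and "\<O> UNIV f \<Longrightarrow> \<O> UNIV g \<Longrightarrow> D (\<lambda>x. f x * g x) = D f * g b + f b * D g"
    and "\<O> UNIV f \<Longrightarrow> D (\<lambda>x. c * f x) = c * D f"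
  using assms unfolding tangent_def by blast+

lemma vector_fieldsD:
  assumes "Z \<in> vector_fields \<O>"
  shows "(\<lambda>f. Z f b) \<in> tangent \<O> b" and "\<O> UNIV f \<Longrightarrow> \<O> UNIV (Z f)"
  using assms unfolding vector_fields_def by blast+

context function_sheaf
begin

lemmas tangentD = tangentD[where \<O> = \<O>]
  and vector_fieldsD = vector_fieldsD[where \<O> = \<O>]
  and connectionD = connectionD[where \<O> = \<O>]
  and flat_connection_curvature = flat_connection_curvature[where \<O> = \<O>]

lemma tangent_const:
  assumes "D \<in> tangent \<O> b"
  shows "D (\<lambda>_. c) = 0"
proof -
  \<comment> \<open>The Leibniz rule for \<open>1 = 1 * 1\<close> gives
    \<open>D 1 = D 1 + D 1\<close>.\<close>
  have "D (\<lambda>x. 1) = 0" using tangentD(3)[OF assms, of "\<lambda>_. 1" "\<lambda>_. 1"] const by simp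
  then show ?thesis using tangentD(4)[OF assms, of "\<lambda>_. 1" c] const by simp
qed

lemma tangent_diff:
  assumes "D \<in> tangent \<O> b" "\<O> UNIV f" "\<O> UNIV g"
  shows "D (\<lambda>x. f x - g x) = D f - D g"
proof -
  have "\<O> UNIV (\<lambda>x. - 1 * g x)" by (rule cmult[OF open_UNIV assms(3)])
  from tangentD(2)[OF assms(1,2) this] tangentD(4)[OF assms(1,3), of "- 1"] show ?thesis by simp
qed

lemma tangent_sum:
  assumes "D \<in> tangent \<O> b" "\<And>i. i \<in> I \<Longrightarrow> \<O> UNIV (f i)"
  shows "D (\<lambda>x. \<Sum>i\<in>I. f i x) = (\<Sum>i\<in>I. D (f i))"
  using assms(2)
proof (induction I rule: infinite_finite_induct)
  case (insert i I)
  then show ?case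
    using tangentD(2)[OF assms(1), of "f i" "\<lambda>x. \<Sum>i\<in>I. f i x"] sum[of UNIV I f] by simp
qed (auto simp: tangent_const[OF assms(1)])

end

section \<open>Vector bundles over a function ring\<close>

locale sheaf_bundle = function_sheaf \<O>
  for \<O> :: "('b::topological_space, 'r::comm_ring_1) sheaf" +
  fixes H :: "('b, 'r, 'h::ab_group_add) vbundle"
  assumes vector_bundle: "vector_bundle \<O> H"
begin

sublocale module "smul H"
  using vector_bundle unfolding vector_bundle_def by (elim conjE)

lemma subspace_fibre: "subspace (fibre H b)"
  using vector_bundle unfolding vector_bundle_def by (elim conjE) blast

lemmas fibre_0 = subspace_0[OF subspace_fibre]
  and fibre_add = subspace_add[OF subspace_fibre]
  and fibre_diff = subspace_diff[OF subspace_fibre]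
  and fibre_neg = subspace_neg[OF subspace_fibre]
  and fibre_scale = subspace_scale[OF subspace_fibre]

lemma frames_cover: obtains U r e where "(U, r, e) \<in> frames H" "b \<in> U"
proof -
  have "(\<Union>(U, r, e) \<in> frames H. U) = UNIV"
    using vector_bundle unfolding vector_bundle_def by (elim conjE)
  then have "b \<in> (\<Union>(U, r, e) \<in> frames H. U)" by (simp only: UNIV_I)
  then show ?thesis by (elim UN_E) (auto intro: that)
qed

lemma frame:
  assumes "(U, r, e) \<in> frames H"
  shows frame_open: "open U"
    and frame_basis: "b \<in> U \<Longrightarrow> is_basis (smul H) (fibre H b) r (\<lambda>i. e i b)"
proof -
  have "\<forall>(U, r, e) \<in> frames H. open U \<and> (\<forall>b\<in>U. is_basis (smul H) (fibre H b) r (\<lambda>i. e i b))"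
    using vector_bundle unfolding vector_bundle_def by (elim conjE)
  from bspec[OF this assms] show "open U"
    and "b \<in> U \<Longrightarrow> is_basis (smul H) (fibre H b) r (\<lambda>i. e i b)" by auto
qed

lemma section_onE:
  assumes "section_on \<O> H W s" "(U, r, e) \<in> frames H"
  obtains c where "\<And>i. i < r \<Longrightarrow> \<O> (W \<inter> U) (c i)"
    "\<And>b. b \<in> W \<inter> U \<Longrightarrow> s b = (\<Sum>i<r. smul H (c i b) (e i b))"
  using assms unfolding section_on_def by blast

lemma section_onI:
  assumes "\<And>b. b \<in> W \<Longrightarrow> s b \<in> fibre H b"
    and "\<And>U r e. (U, r, e) \<in> frames H \<Longrightarrow> \<exists>c. (\<forall>i<r. \<O> (W \<inter> U) (c i)) \<and>
            (\<forall>b \<in> W \<inter> U. s b = (\<Sum>i<r. smul H (c i b) (e i b)))"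
  shows "section_on \<O> H W s"
  using assms unfolding section_on_def by blast

text \<open>The transition functions of the bundle are the coefficients that
  \<open>section_on\<close> demands; they only have to be restricted from
  \<open>U \<inter> V\<close> to \<open>W \<inter> V\<close>.\<close>

lemma frame_section:
  assumes "(U, r, e) \<in> frames H" "i < r" "W \<subseteq> U"
  shows "section_on \<O> H W (e i)"
proof -
  have "\<exists>c. (\<forall>j<q. \<O> (W \<inter> V) (c j)) \<and> (\<forall>b\<in>W \<inter> V. e i b = (\<Sum>j<q. smul H (c j b) (f j b)))"
    if "(V, q, f) \<in> frames H" for V q f
  proof -
    have "\<forall>(U, r, e) \<in> frames H. \<forall>(V, q, f) \<in> frames H. \<forall>i<r.
        \<exists>c. (\<forall>j<q. \<O> (U \<inter> V) (c j)) \<and>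
            (\<forall>b \<in> U \<inter> V. e i b = (\<Sum>j<q. smul H (c j b) (f j b)))"
      using vector_bundle unfolding vector_bundle_def by (elim conjE)
    from bspec[OF bspec[OF this assms(1), simplified] that] assms(2)
    have "\<exists>c. (\<forall>j<q. \<O> (U \<inter> V) (c j)) \<and>
            (\<forall>b \<in> U \<inter> V. e i b = (\<Sum>j<q. smul H (c j b) (f j b)))"
      by auto
    then obtain c where "\<forall>j<q. \<O> (U \<inter> V) (c j)"
      "\<forall>b\<in>U \<inter> V. e i b = (\<Sum>j<q. smul H (c j b) (f j b))"
      by blast
    moreover have "W \<inter> V \<subseteq> U \<inter> V" using assms(3) by blast
    ultimately have "(\<forall>j<q. \<O> (W \<inter> V) (c j)) \<and> (\<forall>b\<in>W \<inter> V. e i b = (\<Sum>j<q. smul H (c j b) (f j b)))"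
      by (auto intro: restrict)
    then show ?thesis by (rule exI[of _ c])
  qed
  moreover have "e i b \<in> fibre H b" if "b \<in> W" for b
    using frame_basis[OF assms(1)] assms(2,3) that by (auto simp: is_basis_def)
  ultimately show ?thesis by (intro section_onI)
qed

lemma section_zero: "section_on \<O> H W (\<lambda>_. 0)"
  by (rule section_onI) (auto intro!: fibre_0 exI[of _ "\<lambda>_ _. 0"] const)

lemma section_add:
  assumes "open W" "section_on \<O> H W s" "section_on \<O> H W t"
  shows "section_on \<O> H W (\<lambda>b. s b + t b)"
proof (rule section_onI)
  fix U r e assume F: "(U, r, e) \<in> frames H"
  obtain c where c: "\<And>i. i < r \<Longrightarrow> \<O> (W \<inter> U) (c i)"
    "\<And>b. b \<in> W \<inter> U \<Longrightarrow> s b = (\<Sum>i<r. smul H (c i b) (e i b))"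
    using section_onE[OF assms(2) F] by blast
  obtain d where d: "\<And>i. i < r \<Longrightarrow> \<O> (W \<inter> U) (d i)"
    "\<And>b. b \<in> W \<inter> U \<Longrightarrow> t b = (\<Sum>i<r. smul H (d i b) (e i b))"
    using section_onE[OF assms(3) F] by blast
  show "\<exists>c. (\<forall>i<r. \<O> (W \<inter> U) (c i)) \<and>
      (\<forall>b \<in> W \<inter> U. s b + t b = (\<Sum>i<r. smul H (c i b) (e i b)))"
    using c d assms(1) frame_open[OF F]
    by (intro exI[of _ "\<lambda>i b. c i b + d i b"]) (simp add: scale_left_distrib sum.distrib add open_Int)
qed (use assms in \<open>auto intro: fibre_add section_on_fibre\<close>)

lemma section_smul:
  assumes "open W" "\<O> W f" "section_on \<O> H W s"
  shows "section_on \<O> H W (\<lambda>b. smul H (f b) (s b))"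
proof (rule section_onI)
  fix U r e assume F: "(U, r, e) \<in> frames H"
  obtain c where c: "\<And>i. i < r \<Longrightarrow> \<O> (W \<inter> U) (c i)"
    "\<And>b. b \<in> W \<inter> U \<Longrightarrow> s b = (\<Sum>i<r. smul H (c i b) (e i b))"
    using section_onE[OF assms(3) F] by blast
  show "\<exists>c. (\<forall>i<r. \<O> (W \<inter> U) (c i)) \<and>
      (\<forall>b \<in> W \<inter> U. smul H (f b) (s b) = (\<Sum>i<r. smul H (c i b) (e i b)))"
    using c assms(1,2) frame_open[OF F] restrict[of W f "W \<inter> U"]
    by (intro exI[of _ "\<lambda>i b. f b * c i b"]) (simp add: scale_sum_right mult open_Int)
qed (use assms in \<open>auto intro: fibre_scale section_on_fibre\<close>)

lemma section_neg:
  assumes "open W" "section_on \<O> H W s"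
  shows "section_on \<O> H W (\<lambda>b. - s b)"
  using section_smul[OF assms(1) const assms(2), of "- 1"] by simp

lemma section_diff:
  assumes "open W" "section_on \<O> H W s" "section_on \<O> H W t"
  shows "section_on \<O> H W (\<lambda>b. s b - t b)"
  using section_add[OF assms(1,2) section_neg[OF assms(1,3)]] by simp

end

lemma linear_onD:
  assumes "linear_on s F t \<phi>"
  shows "x \<in> F \<Longrightarrow> y \<in> F \<Longrightarrow> \<phi> (x + y) = \<phi> x + \<phi> y" and "x \<in> F \<Longrightarrow> \<phi> (s c x) = t c (\<phi> x)"
  using assms by (auto simp: linear_on_def)

section \<open>The para-Kaehler structure over an arbitrary function ring\<close>

text \<open>\<open>V\<close> is kept apart from the fields along \<open>B\<close>: the connections
  of a family also differentiate along \<open>u\<close>, those of its reduction do not.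
  \<open>two_unit\<close> is what lets the eigenvalues \<open>1\<close> and \<open>-1\<close> of
  \<open>J\<close> separate the two summands.\<close>

locale legendre_bundle = function_sheaf \<O>
  for \<O> :: "('b::topological_space, 'r::comm_ring_1) sheaf" +
  fixes V :: "('b, 'r) vfield set"
    and L :: "('b, 'r, 'h::ab_group_add, 'p) legendre"
  assumes legendre: "legendre_structure \<O> V L"
    and fields: "vector_fields \<O> \<subseteq> V"
    and two_unit: "(2::'r) dvd 1"
begin

abbreviation "H \<equiv> hbundle L"
abbreviation "P \<equiv> hplus L"
abbreviation "M \<equiv> hminus L"

lemmas structure_conds = legendre[unfolded legendre_structure_def]

lemmas splitting = structure_conds[THEN conjunct1]
  and pairing = structure_conds[THEN conjunct2, THEN conjunct1]
  and flat_total = structure_conds[THEN conjunct2, THEN conjunct2, THEN conjunct1]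
    structure_conds[THEN conjunct2, THEN conjunct2, THEN conjunct2, THEN conjunct1]
  and dual = structure_conds[THEN conjunct2, THEN conjunct2, THEN conjunct2, THEN conjunct2, THEN conjunct1]

lemmas flat_plus = flat_connection_mono[where \<O> = \<O>, OF flat_total(1) fields]
  and flat_minus = flat_connection_mono[where \<O> = \<O>, OF flat_total(2) fields]

lemmas splitting_conds = splitting[unfolded legendre_splitting_def]

lemmas direct_sum = splitting_conds[THEN conjunct2, THEN conjunct2, THEN conjunct2, THEN conjunct1]

sublocale H: sheaf_bundle \<O> H
  by unfold_locales (rule splitting_conds[THEN conjunct1])

sublocale P: sheaf_bundle \<O> P
  by unfold_locales (rule splitting_conds[THEN conjunct2, THEN conjunct1])

sublocale M: sheaf_bundle \<O> M
  by unfold_locales (rule splitting_conds[THEN conjunct2, THEN conjunct2, THEN conjunct1])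

lemma smul_eq: "smul P = smul H" "smul M = smul H"
  using direct_sum unfolding direct_sum_bundle_def by auto

lemmas P_scale = P.fibre_scale[unfolded smul_eq]
  and M_scale = M.fibre_scale[unfolded smul_eq]

lemma fibre_Int: "x \<in> fibre P b \<Longrightarrow> x \<in> fibre M b \<Longrightarrow> x = 0"
  using direct_sum unfolding direct_sum_bundle_def by blast

lemma fibre_H: "x \<in> fibre H b \<longleftrightarrow> (\<exists>p\<in>fibre P b. \<exists>m\<in>fibre M b. x = p + m)"
  using direct_sum unfolding direct_sum_bundle_def by auto

lemma fibre_sum: "p \<in> fibre P b \<Longrightarrow> m \<in> fibre M b \<Longrightarrow> p + m \<in> fibre H b"
  using fibre_H by blast

lemma P_fibre_H: "x \<in> fibre P b \<Longrightarrow> x \<in> fibre H b"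
  using fibre_sum[of x b 0] M.fibre_0 by simp

lemma M_fibre_H: "x \<in> fibre M b \<Longrightarrow> x \<in> fibre H b"
  using fibre_sum[of 0 b x] P.fibre_0 by simp

lemma section_sum:
  assumes "open W" "\<And>b. b \<in> W \<Longrightarrow> p b \<in> fibre P b" "\<And>b. b \<in> W \<Longrightarrow> m b \<in> fibre M b"
  shows "section_on \<O> H W (\<lambda>b. p b + m b) \<longleftrightarrow> section_on \<O> P W p \<and> section_on \<O> M W m"
proof -
  have "\<forall>W p m. open W \<longrightarrow> (\<forall>b\<in>W. p b \<in> fibre P b \<and> m b \<in> fibre M b) \<longrightarrow>
      section_on \<O> H W (\<lambda>b. p b + m b) \<longleftrightarrow> section_on \<O> P W p \<and> section_on \<O> M W m"
    using direct_sum unfolding direct_sum_bundle_def by (elim conjE)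
  then show ?thesis using assms by simp
qed

lemma section_sumI:
  assumes "open W" "section_on \<O> P W p" "section_on \<O> M W m"
  shows "section_on \<O> H W (\<lambda>b. p b + m b)"
  using section_sum[OF assms(1), of p m] assms(2,3)
    section_on_fibre[OF assms(2)] section_on_fibre[OF assms(3)] by simp

lemma P_section_H:
  assumes "open W" "section_on \<O> P W p" shows "section_on \<O> H W p"
  using section_sumI[OF assms M.section_zero] by simp

lemma M_section_H:
  assumes "open W" "section_on \<O> M W p" shows "section_on \<O> H W p"
  using section_sumI[OF assms(1) P.section_zero assms(2)] by simp

section \<open>Projections\<close>

lemma proj_plus_sum:
  assumes "p \<in> fibre P b" "m \<in> fibre M b"
  shows "proj_plus L b (p + m) = p"
  unfolding proj_plus_def
proof (rule the_equality)
  show "p \<in> fibre P b \<and> p + m - p \<in> fibre M b" using assms by simp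
next
  fix p' assume p': "p' \<in> fibre P b \<and> p + m - p' \<in> fibre M b"
  \<comment> \<open>Two candidates \<open>p\<close> and \<open>p'\<close> for the projection differ
    by an element of both summands.\<close>
  have "p + m - p' - m \<in> fibre M b" using p' assms by (blast intro: M.fibre_diff)
  moreover have "p - p' \<in> fibre P b" using p' assms by (blast intro: P.fibre_diff)
  ultimately have "p - p' = 0" by (intro fibre_Int[of _ b]) (simp_all add: algebra_simps)
  then show "p' = p" by simp
qed

lemma proj_minus_sum: "p \<in> fibre P b \<Longrightarrow> m \<in> fibre M b \<Longrightarrow> proj_minus L b (p + m) = m"
  by (simp add: proj_minus_def proj_plus_sum)

lemma J_sum: "p \<in> fibre P b \<Longrightarrow> m \<in> fibre M b \<Longrightarrow> induced_J L b (p + m) = p - m"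
  by (simp add: induced_J_def proj_plus_sum proj_minus_sum)

lemma J_plus: "p \<in> fibre P b \<Longrightarrow> induced_J L b p = p"
  using J_sum[of p b 0] M.fibre_0 by simp

lemma J_minus: "m \<in> fibre M b \<Longrightarrow> induced_J L b m = - m"
  using J_sum[of 0 b m] P.fibre_0 by simp

lemma proj_fibre:
  assumes "x \<in> fibre H b"
  shows proj_plus_fibre: "proj_plus L b x \<in> fibre P b"
    and proj_minus_fibre: "proj_minus L b x \<in> fibre M b"
  using assms by (auto simp: fibre_H proj_plus_sum proj_minus_sum)

lemma proj_sum: "proj_plus L b x + proj_minus L b x = x"
  by (simp add: proj_minus_def)

lemma proj_add:
  assumes "x \<in> fibre H b" "y \<in> fibre H b"
  shows "proj_plus L b (x + y) = proj_plus L b x + proj_plus L b y"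
    and "proj_minus L b (x + y) = proj_minus L b x + proj_minus L b y"
proof -
  have *: "x + y = (proj_plus L b x + proj_plus L b y) + (proj_minus L b x + proj_minus L b y)"
    by (simp add: proj_minus_def)
  show "proj_plus L b (x + y) = proj_plus L b x + proj_plus L b y"
    using proj_plus_sum[OF P.fibre_add[OF assms[THEN proj_plus_fibre]]
        M.fibre_add[OF assms[THEN proj_minus_fibre]]] by (simp only: * [symmetric])
  then show "proj_minus L b (x + y) = proj_minus L b x + proj_minus L b y"
    by (simp add: proj_minus_def)
qed

lemma proj_smul:
  assumes "x \<in> fibre H b"
  shows "proj_plus L b (smul H c x) = smul H c (proj_plus L b x)"
    and "proj_minus L b (smul H c x) = smul H c (proj_minus L b x)"
proof -
  have *: "smul H c x = smul H c (proj_plus L b x) + smul H c (proj_minus L b x)"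
    by (simp add: proj_sum flip: H.scale_right_distrib)
  show "proj_plus L b (smul H c x) = smul H c (proj_plus L b x)"
    using proj_plus_sum[OF P_scale[OF assms[THEN proj_plus_fibre], of c]
        M_scale[OF assms[THEN proj_minus_fibre], of c]] by (simp only: * [symmetric])
  then show "proj_minus L b (smul H c x) = smul H c (proj_minus L b x)"
    by (simp add: proj_minus_def H.scale_right_diff_distrib)
qed

lemma proj_section:
  assumes "open W" "section_on \<O> H W s"
  shows proj_plus_section: "section_on \<O> P W (\<lambda>b. proj_plus L b (s b))"
    and proj_minus_section: "section_on \<O> M W (\<lambda>b. proj_minus L b (s b))"
  using section_sum[OF assms(1), of "\<lambda>b. proj_plus L b (s b)" "\<lambda>b. proj_minus L b (s b)"]
    section_on_fibre[OF assms(2)] assms(2)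
  by (simp_all add: proj_sum proj_fibre)

lemma J_fibre: "x \<in> fibre H b \<Longrightarrow> induced_J L b x \<in> fibre H b"
  by (simp add: induced_J_def H.fibre_diff P_fibre_H M_fibre_H proj_fibre)

lemma J_section:
  assumes "open W" "section_on \<O> H W s"
  shows "section_on \<O> H W (\<lambda>b. induced_J L b (s b))"
  unfolding induced_J_def using P_section_H[OF assms(1) proj_plus_section[OF assms]]
    M_section_H[OF assms(1) proj_minus_section[OF assms]] by (rule H.section_diff[OF assms(1)])

lemma J_linear: "linear_on (smul H) (fibre H b) (smul H) (induced_J L b)"
  by (simp add: linear_on_def induced_J_def proj_add proj_smul H.scale_right_diff_distrib)

lemma J_endomorphism: "bundle_endomorphism \<O> H (induced_J L)"
  unfolding bundle_endomorphism_def using J_fibre J_linear J_section by blast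

lemma J_J: "x \<in> fibre H b \<Longrightarrow> induced_J L b (induced_J L b x) = x"
  using J_sum[of "proj_plus L b x" b "- proj_minus L b x"] M.fibre_neg
  by (simp add: proj_fibre proj_sum induced_J_def)

text \<open>If \<open>1 = 2 * c\<close>, then every \<open>x\<close> is \<open>c\<close> times
  \<open>x + x\<close>.\<close>

lemma double_eq_0:
  fixes x :: 'h
  assumes "x + x = 0" shows "x = 0"
proof -
  obtain c :: 'r where c: "1 = 2 * c" using two_unit by (rule dvdE)
  have "x = smul H (2 * c) x" by (simp flip: c)
  also have "\<dots> = smul H c (x + x)"
    by (simp only: mult_2 H.scale_right_distrib H.scale_left_distrib)
  finally show ?thesis using assms by simp
qed

text \<open>For \<open>x = p + m\<close> the equation \<open>J x = x\<close> says
  \<open>m + m = 0\<close>, and \<open>J x = - x\<close> says \<open>p + p = 0\<close>.\<close>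

lemma J_eigenspaces:
  "{x \<in> fibre H b. induced_J L b x = x} = fibre P b"
  "{x \<in> fibre H b. induced_J L b x = - x} = fibre M b"
proof -
  have "x \<in> fibre P b" if "x \<in> fibre H b" "induced_J L b x = x" for x
  proof -
    have "proj_minus L b x + proj_minus L b x = 0"
      using that(2) by (simp add: induced_J_def proj_minus_def algebra_simps)
    then have "proj_minus L b x = 0" by (rule double_eq_0)
    then show ?thesis using proj_plus_fibre[OF that(1)] proj_sum[of b x] by simp
  qed
  then show "{x \<in> fibre H b. induced_J L b x = x} = fibre P b"
    using P_fibre_H J_plus by blast
  have "x \<in> fibre M b" if "x \<in> fibre H b" "induced_J L b x = - x" for x
  proof -
    have "proj_plus L b x + proj_plus L b x = 0"
      using that(2) by (simp add: induced_J_def proj_minus_def algebra_simps)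
    then have "proj_plus L b x = 0" by (rule double_eq_0)
    then show ?thesis using proj_minus_fibre[OF that(1)] proj_sum[of b x] by simp
  qed
  then show "{x \<in> fibre H b. induced_J L b x = - x} = fibre M b"
    using M_fibre_H J_minus by blast
qed

text \<open>The comparison of ranks is left as a hypothesis so that the ring can stay arbitrary;
  linear algebra over \<open>k\<close> supplies it for both rings. Frames of the summands count as
  local frames inside \<open>H\<close> because their sections are sections of
  \<open>H\<close>.\<close>

lemma equal_rank_PM:
  assumes frames_rank: "\<And>U r e W q f. (U, r, e) \<in> frames P \<Longrightarrow> (W, q, f) \<in> frames M \<Longrightarrow>
    U \<inter> W \<noteq> {} \<Longrightarrow> r = q"
  shows "equal_rank \<O> H (fibre P) (fibre M)"
  unfolding equal_rank_def
proof
  fix p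
  obtain U r e where U: "(U, r, e) \<in> frames P" "p \<in> U" by (rule P.frames_cover)
  obtain W q f where W: "(W, q, f) \<in> frames M" "p \<in> W" by (rule M.frames_cover)
  have "r = q" using frames_rank[OF U(1) W(1)] U W by blast
  have op: "open (U \<inter> W)" using P.frame_open[OF U(1)] M.frame_open[OF W(1)] by blast
  have "local_frame \<O> H (fibre P) (U \<inter> W) r e"
    unfolding local_frame_def
    using P.frame_section[OF U(1)] P.frame_basis[OF U(1)] P_section_H[OF op] smul_eq(1) by auto
  moreover have "local_frame \<O> H (fibre M) (U \<inter> W) q f"
    unfolding local_frame_def
    using M.frame_section[OF W(1)] M.frame_basis[OF W(1)] M_section_H[OF op] smul_eq(2) by auto
  ultimately show "\<exists>U r e f. open U \<and> p \<in> U \<and>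
      local_frame \<O> H (fibre P) U r e \<and> local_frame \<O> H (fibre M) U r f"
    using op U(2) W(2) \<open>r = q\<close> by blast
qed

section \<open>The symplectic form\<close>

lemmas pairing_conds = pairing[unfolded legendre_pairing_def]

lemmas bilinear = pairing_conds[THEN conjunct1]
  and nondegenerate = pairing_conds[THEN conjunct2, THEN conjunct1]

lemma pairing_sym: "x \<in> fibre H b \<Longrightarrow> y \<in> fibre H b \<Longrightarrow> pairing L b x y = pairing L b y x"
  using pairing_conds[THEN conjunct2, THEN conjunct2, THEN conjunct1] by blast

lemma pairing_PP: "x \<in> fibre P b \<Longrightarrow> y \<in> fibre P b \<Longrightarrow> pairing L b x y = 0"
  using pairing_conds[THEN conjunct2, THEN conjunct2, THEN conjunct2, THEN conjunct1] by blast

lemma pairing_MM: "x \<in> fibre M b \<Longrightarrow> y \<in> fibre M b \<Longrightarrow> pairing L b x y = 0"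
  using pairing_conds[THEN conjunct2, THEN conjunct2, THEN conjunct2, THEN conjunct2, THEN conjunct1]
  by blast

lemma pairing_linear:
  assumes "x \<in> fibre H b"
  shows "linear_on (smul H) (fibre H b) (*) (pairing L b x)"
    and "linear_on (smul H) (fibre H b) (*) (\<lambda>y. pairing L b y x)"
  using bilinear[unfolded bilinear_form_def, THEN conjunct1] assms by blast+

lemma pairing_add:
  assumes "x \<in> fibre H b" "y \<in> fibre H b" "z \<in> fibre H b"
  shows "pairing L b x (y + z) = pairing L b x y + pairing L b x z"
    and "pairing L b (y + z) x = pairing L b y x + pairing L b z x"
  using linear_onD(1)[OF pairing_linear(1)[OF assms(1)]] linear_onD(1)[OF pairing_linear(2)[OF assms(1)]]
    assms by simp_all

lemma pairing_smul:
  assumes "x \<in> fibre H b" "y \<in> fibre H b"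
  shows "pairing L b x (smul H c y) = c * pairing L b x y"
    and "pairing L b (smul H c y) x = c * pairing L b y x"
  using linear_onD(2)[OF pairing_linear(1)[OF assms(1)]] linear_onD(2)[OF pairing_linear(2)[OF assms(1)]]
    assms by simp_all

lemma pairing_minus:
  assumes "x \<in> fibre H b" "y \<in> fibre H b"
  shows "pairing L b x (- y) = - pairing L b x y" and "pairing L b (- y) x = - pairing L b y x"
  using pairing_smul[OF assms, of "- 1"] by simp_all

lemma pairing_section:
  "open W \<Longrightarrow> section_on \<O> H W s \<Longrightarrow> section_on \<O> H W t \<Longrightarrow> \<O> W (\<lambda>b. pairing L b (s b) (t b))"
  using bilinear[unfolded bilinear_form_def, THEN conjunct2] by blast

text \<open>The canonical symplectic form on the sum of a space and its dual. Two of the four terms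
  of the expansion vanish by isotropy; skewness and the sign under \<open>J\<close> can be seen from
  what remains.\<close>

lemma omega_sum:
  assumes "p \<in> fibre P b" "m \<in> fibre M b" "q \<in> fibre P b" "n \<in> fibre M b"
  shows "induced_omega L b (p + m) (q + n) = pairing L b p n - pairing L b q m"
proof -
  have H: "p \<in> fibre H b" "- m \<in> fibre H b" "m \<in> fibre H b" "q \<in> fibre H b" "n \<in> fibre H b"
    using assms P_fibre_H M_fibre_H H.fibre_neg by auto
  have "induced_omega L b (p + m) (q + n) = pairing L b (p + - m) (q + n)"
    using J_sum[OF assms(1,2)] by (simp add: induced_omega_def)
  also have "\<dots> = pairing L b p n - pairing L b q m"
    using H assms H.fibre_add[OF H(4,5)]
    by (simp only: pairing_add pairing_minus pairing_PP pairing_MM)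
      (simp add: pairing_sym[of m b q])
  finally show ?thesis .
qed

lemma omega_proj:
  assumes "x \<in> fibre H b" "y \<in> fibre H b"
  shows "induced_omega L b x y = pairing L b (proj_plus L b x) (proj_minus L b y)
           - pairing L b (proj_plus L b y) (proj_minus L b x)"
  using omega_sum[OF assms(1)[THEN proj_plus_fibre] assms(1)[THEN proj_minus_fibre]
      assms(2)[THEN proj_plus_fibre] assms(2)[THEN proj_minus_fibre]]
  by (simp add: proj_sum)

lemma omega_bilinear: "bilinear_form \<O> H (induced_omega L)"
  unfolding bilinear_form_def
proof (intro conjI allI ballI impI)
  fix b x assume x: "x \<in> fibre H b"
  show "linear_on (smul H) (fibre H b) (*) (induced_omega L b x)"
    using pairing_linear(1)[OF J_fibre[OF x]] by (simp add: induced_omega_def linear_on_def)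
  show "linear_on (smul H) (fibre H b) (*) (\<lambda>y. induced_omega L b y x)"
    using x J_fibre pairing_add(2) pairing_smul(2) linear_onD[OF J_linear]
    by (simp add: induced_omega_def linear_on_def)
next
  fix W s t assume "open W" "section_on \<O> H W s" "section_on \<O> H W t"
  then show "\<O> W (\<lambda>b. induced_omega L b (s b) (t b))"
    unfolding induced_omega_def by (intro pairing_section J_section)
qed

text \<open>As \<open>J\<close> is an involution, the form with \<open>J x\<close> in its first slot
  is the pairing with \<open>x\<close>, so the vectors representing a functional for the two forms
  correspond under \<open>J\<close>.\<close>

lemma omega_nondegenerate: "nondegenerate H (induced_omega L)"
  unfolding nondegenerate_def
proof (intro allI impI)
  fix b \<mu> assume "linear_on (smul H) (fibre H b) (*) \<mu>"
  then have ex1: "\<exists>!x. x \<in> fibre H b \<and> (\<forall>y\<in>fibre H b. pairing L b x y = \<mu> y)"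
    using nondegenerate unfolding nondegenerate_def by blast
  then obtain x where x: "x \<in> fibre H b" "\<forall>y\<in>fibre H b. pairing L b x y = \<mu> y" by blast
  show "\<exists>!x. x \<in> fibre H b \<and> (\<forall>y\<in>fibre H b. induced_omega L b x y = \<mu> y)"
  proof (rule ex1I[of _ "induced_J L b x"])
    show "induced_J L b x \<in> fibre H b \<and> (\<forall>y\<in>fibre H b. induced_omega L b (induced_J L b x) y = \<mu> y)"
      using x by (simp add: induced_omega_def J_J J_fibre)
    fix z assume z: "z \<in> fibre H b \<and> (\<forall>y\<in>fibre H b. induced_omega L b z y = \<mu> y)"
    then have "induced_J L b z = x"
      using ex1 x J_fibre unfolding induced_omega_def by blast
    then show "z = induced_J L b x" using z J_J[of z b] by simp
  qed
qed

lemma omega_skew: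
  "x \<in> fibre H b \<Longrightarrow> y \<in> fibre H b \<Longrightarrow> induced_omega L b x y = - induced_omega L b y x"
  by (simp add: omega_proj)

lemma omega_J:
  assumes "x \<in> fibre H b" "y \<in> fibre H b"
  shows "induced_omega L b (induced_J L b x) (induced_J L b y) = - induced_omega L b x y"
proof -
  note pm = assms(1)[THEN proj_plus_fibre] assms(1)[THEN proj_minus_fibre]
    assms(2)[THEN proj_plus_fibre] assms(2)[THEN proj_minus_fibre]
  have "induced_omega L b (induced_J L b x) (induced_J L b y)
      = pairing L b (proj_plus L b x) (- proj_minus L b y) - pairing L b (proj_plus L b y) (- proj_minus L b x)"
    using omega_sum[OF pm(1) M.fibre_neg[OF pm(2)] pm(3) M.fibre_neg[OF pm(4)]]
    by (simp add: induced_J_def)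
  then show ?thesis
    using assms pm by (simp add: pairing_minus P_fibre_H M_fibre_H omega_proj)
qed

section \<open>The connection\<close>

lemma dual_Z:
  assumes "Z \<in> vector_fields \<O>" "s \<in> sections \<O> P" "t \<in> sections \<O> M"
  shows "Z (\<lambda>x. pairing L x (s x) (t x)) b
           = pairing L b (nabla_plus L Z s b) (t b) + pairing L b (s b) (nabla_minus L Z t b)"
  using dual assms fields unfolding dual_connections_def by blast

lemma conn_plus: "connection \<O> (vector_fields \<O>) P (nabla_plus L)"
  and conn_minus: "connection \<O> (vector_fields \<O>) M (nabla_minus L)"
  using flat_plus flat_minus by (auto simp: flat_connection_def)

lemmas plusD = connectionD[OF conn_plus, unfolded smul_eq]
  and minusD = connectionD[OF conn_minus, unfolded smul_eq]

lemma proj_sections: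
  assumes "s \<in> sections \<O> H"
  shows "(\<lambda>y. proj_plus L y (s y)) \<in> sections \<O> P" "(\<lambda>y. proj_minus L y (s y)) \<in> sections \<O> M"
  using assms proj_section[OF open_UNIV] by (simp_all add: sections_iff)

text \<open>The connection is diagonal with respect to the splitting, so curvature, \<open>J\<close>
  and the form can be treated one summand at a time.\<close>

lemma proj_nabla:
  assumes "Z \<in> vector_fields \<O>" "s \<in> sections \<O> H"
  shows "proj_plus L b (induced_nabla L Z s b) = nabla_plus L Z (\<lambda>y. proj_plus L y (s y)) b"
    and "proj_minus L b (induced_nabla L Z s b) = nabla_minus L Z (\<lambda>y. proj_minus L y (s y)) b"
  using sections_fibre[OF plusD(1)[OF assms(1) proj_sections(1)[OF assms(2)]]]
    sections_fibre[OF minusD(1)[OF assms(1) proj_sections(2)[OF assms(2)]]]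
  by (simp_all add: induced_nabla_def proj_plus_sum proj_minus_sum)

lemma nabla_section:
  assumes "Z \<in> vector_fields \<O>" "s \<in> sections \<O> H"
  shows "induced_nabla L Z s \<in> sections \<O> H"
  using section_sumI[OF open_UNIV plusD(1)[OF assms(1) proj_sections(1)[OF assms(2)], unfolded sections_iff]
      minusD(1)[OF assms(1) proj_sections(2)[OF assms(2)], unfolded sections_iff]]
  by (simp add: sections_iff induced_nabla_def[abs_def])

lemma nabla_connection: "connection \<O> (vector_fields \<O>) H (induced_nabla L)"
  unfolding connection_def
proof (intro conjI ballI allI impI)
  fix Z s assume Z: "Z \<in> vector_fields \<O>" and s: "s \<in> sections \<O> H"
  note ps = proj_sections[OF s]
  show "induced_nabla L Z s \<in> sections \<O> H" using Z s by (rule nabla_section)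
  show "induced_nabla L (\<lambda>g b. Z g b + Z' g b) s = (\<lambda>b. induced_nabla L Z s b + induced_nabla L Z' s b)"
    if "Z' \<in> vector_fields \<O>" for Z'
    using plusD(2)[OF Z ps(1) that] minusD(2)[OF Z ps(2) that]
    by (simp add: induced_nabla_def fun_eq_iff algebra_simps)
  show "induced_nabla L Z (\<lambda>b. s b + t b) = (\<lambda>b. induced_nabla L Z s b + induced_nabla L Z t b)"
    if "t \<in> sections \<O> H" for t
    using plusD(4)[OF Z ps(1) proj_sections(1)[OF that]] minusD(4)[OF Z ps(2) proj_sections(2)[OF that]]
    by (simp add: induced_nabla_def fun_eq_iff algebra_simps proj_add sections_fibre[OF s] sections_fibre[OF that])
  fix f assume f: "\<O> UNIV f"
  show "induced_nabla L (\<lambda>g b. f b * Z g b) s = (\<lambda>b. smul H (f b) (induced_nabla L Z s b))"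
    using plusD(3)[OF Z ps(1) f] minusD(3)[OF Z ps(2) f]
    by (simp add: induced_nabla_def fun_eq_iff H.scale_right_distrib)
  show "induced_nabla L Z (\<lambda>b. smul H (f b) (s b))
      = (\<lambda>b. smul H (Z f b) (s b) + smul H (f b) (induced_nabla L Z s b))"
  proof
    fix b
    have "smul H (Z f b) (s b) = smul H (Z f b) (proj_plus L b (s b)) + smul H (Z f b) (proj_minus L b (s b))"
      by (simp add: proj_sum flip: H.scale_right_distrib)
    then show "induced_nabla L Z (\<lambda>b. smul H (f b) (s b)) b
        = smul H (Z f b) (s b) + smul H (f b) (induced_nabla L Z s b)"
      using plusD(5)[OF Z ps(1) f] minusD(5)[OF Z ps(2) f]
      by (simp add: induced_nabla_def H.scale_right_distrib proj_smul sections_fibre[OF s] algebra_simps)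
  qed
qed

lemma nabla_flat: "flat_connection \<O> (vector_fields \<O>) H (induced_nabla L)"
  unfolding flat_connection_def
proof (intro conjI ballI allI nabla_connection)
  fix Z W s b assume Z: "Z \<in> vector_fields \<O>" and W: "W \<in> vector_fields \<O>" and s: "s \<in> sections \<O> H"
  note ps = proj_sections[OF s]
  have "induced_nabla L Z (induced_nabla L W s) b
      = nabla_plus L Z (nabla_plus L W (\<lambda>y. proj_plus L y (s y))) b
        + nabla_minus L Z (nabla_minus L W (\<lambda>y. proj_minus L y (s y))) b"
    if "Z \<in> vector_fields \<O>" "W \<in> vector_fields \<O>" for Z W
    by (subst induced_nabla_def) (simp add: proj_nabla[OF that(2) s])
  from this[OF Z W] this[OF W Z] show "induced_nabla L Z (induced_nabla L W s) b
      - induced_nabla L W (induced_nabla L Z s) b - induced_nabla L (bracket Z W) s b = 0"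
    using flat_connection_curvature[OF flat_plus Z W ps(1), of b]
      flat_connection_curvature[OF flat_minus Z W ps(2), of b]
    by (simp add: induced_nabla_def algebra_simps)
qed

lemma nabla_J:
  assumes Z: "Z \<in> vector_fields \<O>" and s: "s \<in> sections \<O> H"
  shows "induced_nabla L Z (\<lambda>y. induced_J L y (s y)) b = induced_J L b (induced_nabla L Z s b)"
proof -
  note ps = proj_sections[OF s]
  have "proj_plus L y (induced_J L y (s y)) = proj_plus L y (s y)"
    "proj_minus L y (induced_J L y (s y)) = smul H (- 1) (proj_minus L y (s y))" for y
    using proj_plus_sum[of "proj_plus L y (s y)" y "- proj_minus L y (s y)"]
      proj_minus_sum[of "proj_plus L y (s y)" y "- proj_minus L y (s y)"]
    by (simp_all add: induced_J_def proj_fibre sections_fibre[OF s] M.fibre_neg)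
  then have "induced_nabla L Z (\<lambda>y. induced_J L y (s y)) b = nabla_plus L Z (\<lambda>y. proj_plus L y (s y)) b
      + nabla_minus L Z (\<lambda>y. smul H (- 1) (proj_minus L y (s y))) b"
    by (simp add: induced_nabla_def)
  \<comment> \<open>The sign passes through the connection as the constant function
    \<open>- 1\<close>, whose derivative vanishes.\<close>
  also have "nabla_minus L Z (\<lambda>y. smul H (- 1) (proj_minus L y (s y))) b
      = - nabla_minus L Z (\<lambda>y. proj_minus L y (s y)) b"
    using minusD(5)[OF Z ps(2) const[of UNIV "- 1"]] tangent_const[OF vector_fieldsD(1)[OF Z]]
    by simp
  finally show ?thesis by (simp add: induced_J_def proj_nabla[OF Z s])
qed

lemma nabla_omega:
  assumes Z: "Z \<in> vector_fields \<O>" and s: "s \<in> sections \<O> H" and t: "t \<in> sections \<O> H"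
  shows "Z (\<lambda>y. induced_omega L y (s y) (t y)) b
    = induced_omega L b (induced_nabla L Z s b) (t b) + induced_omega L b (s b) (induced_nabla L Z t b)"
proof -
  note ps = proj_sections[OF s] and pt = proj_sections[OF t]
  \<comment> \<open>A derivation is known to be additive on the function ring only, so both mixed
    pairings must first be recognised as functions. The duality condition then differentiates each
    of them.\<close>
  have O: "\<O> UNIV (\<lambda>y. pairing L y (proj_plus L y (s y)) (proj_minus L y (t y)))"
    if "s \<in> sections \<O> H" "t \<in> sections \<O> H" for s t
    using pairing_section[OF open_UNIV P_section_H[OF open_UNIV] M_section_H[OF open_UNIV]]
      proj_sections[OF that(1)] proj_sections[OF that(2)] by (simp add: sections_iff)
  have "Z (\<lambda>y. induced_omega L y (s y) (t y)) b
      = Z (\<lambda>y. pairing L y (proj_plus L y (s y)) (proj_minus L y (t y))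
             - pairing L y (proj_plus L y (t y)) (proj_minus L y (s y))) b"
    by (simp add: omega_proj sections_fibre[OF s] sections_fibre[OF t])
  also have "\<dots> = Z (\<lambda>y. pairing L y (proj_plus L y (s y)) (proj_minus L y (t y))) b
             - Z (\<lambda>y. pairing L y (proj_plus L y (t y)) (proj_minus L y (s y))) b"
    using tangent_diff[OF vector_fieldsD(1)[OF Z] O[OF s t] O[OF t s]] .
  also have "\<dots> = induced_omega L b (induced_nabla L Z s b) (t b)
      + induced_omega L b (s b) (induced_nabla L Z t b)"
    using dual_Z[OF Z ps(1) pt(2), of b] dual_Z[OF Z pt(1) ps(2), of b]
    by (simp add: omega_proj proj_nabla Z s t sections_fibre[OF s] sections_fibre[OF t]
        sections_fibre[OF nabla_section[OF Z s]] sections_fibre[OF nabla_section[OF Z t]])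
  finally show ?thesis .
qed

theorem para_kaehler:
  assumes "\<And>U r e W q f. (U, r, e) \<in> frames P \<Longrightarrow> (W, q, f) \<in> frames M \<Longrightarrow>
    U \<inter> W \<noteq> {} \<Longrightarrow> r = q"
  shows "para_kaehler \<O> H (induced_J L) (induced_omega L) (induced_nabla L)"
  unfolding para_kaehler_def J_eigenspaces
  by (intro conjI allI ballI H.vector_bundle J_endomorphism J_J equal_rank_PM[OF assms] omega_bilinear
      omega_nondegenerate omega_skew omega_J nabla_flat nabla_J nabla_omega)

end

section \<open>Constant extension and reduction of functions and vector fields\<close>

lemma fps_split: "f = fps_const (f $ 0) + fps_X * fps_shift 1 (f :: 'k::comm_ring_1 fps)"
proof (rule fps_ext)
  fix n show "f $ n = (fps_const (f $ 0) + fps_X * fps_shift 1 f) $ n"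
    by (cases n) (simp_all add: fps_X_mult_nth)
qed

text \<open>Multiplication by \<open>fps_X\<close> merely shifts coefficients, hence is injective
  whatever the coefficient ring.\<close>

lemma fps_X_cancel: "fps_X * f = fps_X * g \<Longrightarrow> f = (g :: 'k::comm_ring_1 fps)"
proof (rule fps_ext)
  fix n assume "fps_X * f = fps_X * g"
  then have "(fps_X * f) $ Suc n = (fps_X * g) $ Suc n" by simp
  then show "f $ n = g $ n" by (simp add: fps_X_mult_nth)
qed

locale formal_disk =
  S: function_sheaf "smooth A :: ('b, 'k::real_normed_field) sheaf" +
  F: function_sheaf "formal_smooth A :: ('b, 'k fps) sheaf"
  for A :: "('b::topological_space, 'e::euclidean_space) atlas"
begin

abbreviation smth :: "('b, 'k) sheaf" where "smth \<equiv> smooth A"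
abbreviation fsmth :: "('b, 'k fps) sheaf" where "fsmth \<equiv> formal_smooth A"

lemma formal_nth: "fsmth W f \<Longrightarrow> smth W (\<lambda>b. f b $ n)"
  by (simp add: formal_smooth_def)

lemma formalI: "(\<And>n. smth W (\<lambda>b. f b $ n)) \<Longrightarrow> fsmth W f"
  by (simp add: formal_smooth_def)

lemma formal_const: "smth W f \<Longrightarrow> fsmth W (\<lambda>b. fps_const (f b))"
  using S.const by (intro formalI) (case_tac "n = 0"; simp)

lemma formal_shift: "fsmth W f \<Longrightarrow> fsmth W (\<lambda>b. fps_shift n (f b))"
  by (rule formalI) (simp add: formal_nth)

section \<open>Vector fields\<close>

text \<open>\<open>D\<close> acts on each coefficient; the Leibniz rule for series is the one for
  \<open>D\<close> applied to every summand of the Cauchy product.\<close>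

lemma pull_vec_tangent:
  assumes D: "D \<in> tangent smth b"
  shows "pull_vec A D \<in> tangent fsmth b"
proof -
  have "pull_vec A D (\<lambda>x. f x + g x) = pull_vec A D f + pull_vec A D g"
    "pull_vec A D (\<lambda>x. f x * g x) = pull_vec A D f * g b + f b * pull_vec A D g"
    if f: "fsmth UNIV f" and g: "fsmth UNIV g" for f g
  proof -
    note fg = formal_nth[OF f] formal_nth[OF g]
    show "pull_vec A D (\<lambda>x. f x + g x) = pull_vec A D f + pull_vec A D g"
      using f g F.add[OF open_UNIV f g] S.tangentD(2)[OF D fg]
      by (simp add: pull_vec_def fps_eq_iff)
    have "D (\<lambda>y. \<Sum>i=0..n. f y $ i * g y $ (n - i))
        = (\<Sum>i=0..n. D (\<lambda>y. f y $ i) * g b $ (n - i)) + (\<Sum>i=0..n. f b $ i * D (\<lambda>y. g y $ (n - i)))" for n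
      using S.tangent_sum[OF D, of "{0..n}" "\<lambda>i y. f y $ i * g y $ (n - i)"]
        S.mult[OF open_UNIV fg] S.tangentD(3)[OF D fg]
      by (simp add: sum.distrib)
    then show "pull_vec A D (\<lambda>x. f x * g x) = pull_vec A D f * g b + f b * pull_vec A D g"
      using f g F.mult[OF open_UNIV f g]
      by (simp add: pull_vec_def fps_eq_iff fps_mult_nth)
  qed
  moreover have "pull_vec A D (\<lambda>x. c * f x) = c * pull_vec A D f" if f: "fsmth UNIV f" for c f
  proof -
    have "D (\<lambda>y. \<Sum>i=0..n. c $ i * f y $ (n - i)) = (\<Sum>i=0..n. c $ i * D (\<lambda>y. f y $ (n - i)))" for n
      using S.tangent_sum[OF D, of "{0..n}" "\<lambda>i y. c $ i * f y $ (n - i)"]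
        S.cmult[OF open_UNIV formal_nth[OF f]] S.tangentD(4)[OF D formal_nth[OF f]] by simp
    then show ?thesis
      using f F.cmult[OF open_UNIV f] by (simp add: pull_vec_def fps_eq_iff fps_mult_nth)
  qed
  ultimately show ?thesis by (simp add: tangent_def pull_vec_def)
qed

lemma pull_vfield_nth:
  "fsmth UNIV f \<Longrightarrow> pull_vfield A Z f b $ n = (Z (\<lambda>y. f y $ n) b :: 'k)"
  by (simp add: pull_vfield_def pull_vec_def)

lemma pull_vfield_notin:
  "\<not> fsmth UNIV f \<Longrightarrow> pull_vfield A Z f b = 0"
  by (simp add: pull_vfield_def pull_vec_def)

lemma pull_vfield:
  assumes Z: "Z \<in> vector_fields smth"
  shows "pull_vfield A Z \<in> vector_fields fsmth"
proof -
  have "(\<lambda>f. pull_vfield A Z f b) \<in> tangent fsmth b" for b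
    using pull_vec_tangent[OF S.vector_fieldsD(1)[OF Z]] by (simp add: pull_vfield_def)
  moreover have "fsmth UNIV (pull_vfield A Z f)" if "fsmth UNIV f" for f
    using S.vector_fieldsD(2)[OF Z formal_nth[OF that]]
    by (intro formalI) (simp add: pull_vfield_nth[OF that])
  ultimately show ?thesis by (simp add: vector_fields_def)
qed

text \<open>On constant series both Leibniz terms are multiples by a constant series, so the rule
  holds in each coefficient separately.\<close>

lemma vec_coeff_tangent:
  assumes D: "D \<in> tangent fsmth b"
  shows "vec_coeff A D n \<in> tangent smth b"
proof -
  have "vec_coeff A D n (\<lambda>x. f x + g x) = vec_coeff A D n f + vec_coeff A D n g \<and>
    vec_coeff A D n (\<lambda>x. f x * g x) = vec_coeff A D n f * g b + f b * vec_coeff A D n g"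
    if f: "smth UNIV f" and g: "smth UNIV g" for f g
    using f g S.add[OF open_UNIV f g] S.mult[OF open_UNIV f g]
      F.tangentD(2)[OF D formal_const[OF f] formal_const[OF g]]
      F.tangentD(3)[OF D formal_const[OF f] formal_const[OF g]]
    by (simp add: vec_coeff_def)
  moreover have "vec_coeff A D n (\<lambda>x. c * f x) = c * vec_coeff A D n f" if f: "smth UNIV f" for c f
    using f S.cmult[OF open_UNIV f] F.tangentD(4)[OF D formal_const[OF f], of "fps_const c"]
    by (simp add: vec_coeff_def)
  ultimately show ?thesis by (simp add: tangent_def vec_coeff_def)
qed

lemma vfield_at_0:
  assumes Z: "Z \<in> vector_fields fsmth"
  shows "vfield_at_0 A Z \<in> vector_fields smth"
proof -
  have "(\<lambda>f. vfield_at_0 A Z f b) \<in> tangent smth b" for b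
    using vec_coeff_tangent[OF F.vector_fieldsD(1)[OF Z]] by (simp add: vfield_at_0_def)
  moreover have "smth UNIV (vfield_at_0 A Z f)" if "smth UNIV f" for f
    using formal_nth[OF F.vector_fieldsD(2)[OF Z formal_const[OF that]]] that
    by (simp add: vfield_at_0_def[abs_def] vec_coeff_def)
  ultimately show ?thesis by (simp add: vector_fields_def)
qed

text \<open>By linearity over \<open>k[[u]]\<close>, \<open>D\<close> maps multiples of
  \<open>u\<close> to multiples of \<open>u\<close>, and these do not contribute at
  \<open>u = 0\<close>.\<close>

lemma tangent_nth_0:
  assumes D: "D \<in> tangent fsmth b" and f: "fsmth UNIV f"
  shows "D f $ 0 = D (\<lambda>y. fps_const (f y $ 0)) $ 0"
proof -
  note s = formal_shift[OF f, of 1] and c = formal_const[OF formal_nth[OF f], of 0]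
  have "D f = D (\<lambda>y. fps_const (f y $ 0) + fps_X * fps_shift 1 (f y))"
    by (simp only: fps_split [symmetric])
  also have "\<dots> = D (\<lambda>y. fps_const (f y $ 0)) + fps_X * D (\<lambda>y. fps_shift 1 (f y))"
    using F.tangentD(2)[OF D c F.cmult[OF open_UNIV s]] F.tangentD(4)[OF D s] by simp
  finally show ?thesis by simp
qed

text \<open>Valid for every \<open>f\<close>, since off the function ring both operators vanish;
  this makes \<open>vfield_quot_X\<close> an identity of operators.\<close>

lemma pull_vfield_at_0_nth_0:
  assumes Z: "Z \<in> vector_fields fsmth"
  shows "pull_vfield A (vfield_at_0 A Z) f b $ 0 = Z f b $ 0"
proof (cases "fsmth UNIV f")
  case True
  then show ?thesis
    using tangent_nth_0[OF F.vector_fieldsD(1)[OF Z] True]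
    by (simp add: pull_vfield_nth vfield_at_0_def vec_coeff_def formal_nth)
next
  case False
  then show ?thesis
    using F.tangentD(1)[OF F.vector_fieldsD(1)[OF Z]] by (simp add: pull_vfield_notin)
qed

text \<open>The quotient of \<open>Z - Z\<^sub>0\<close> by \<open>u\<close>, where \<open>Z\<^sub>0\<close> is the constant extension of the reduction of \<open>Z\<close>.\<close>

definition vfield_quot :: "('b, 'k fps) vfield \<Rightarrow> ('b, 'k fps) vfield" where
  "vfield_quot Z = (\<lambda>f b. fps_shift 1 (Z f b - pull_vfield A (vfield_at_0 A Z) f b))"

lemma vfield_quot_X:
  assumes "Z \<in> vector_fields fsmth"
  shows "fps_X * vfield_quot Z f b = Z f b - pull_vfield A (vfield_at_0 A Z) f b"
  using fps_split[of "Z f b - pull_vfield A (vfield_at_0 A Z) f b"]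
  by (simp add: vfield_quot_def pull_vfield_at_0_nth_0[OF assms])

text \<open>The algebraic identities of a derivation are checked after multiplication by
  \<open>u\<close>, where they are differences of the identities for \<open>Z\<close> and for the
  constant extension of its reduction; then \<open>u\<close> is cancelled.\<close>

lemma vfield_quot:
  assumes Z: "Z \<in> vector_fields fsmth"
  shows "vfield_quot Z \<in> vector_fields fsmth"
proof -
  let ?Z0 = "pull_vfield A (vfield_at_0 A Z)"
  have Z0: "?Z0 \<in> vector_fields fsmth" by (intro pull_vfield vfield_at_0 Z)
  note X = vfield_quot_X[OF Z]
  have "(\<lambda>f. vfield_quot Z f b) \<in> tangent fsmth b" for b
  proof -
    note D = F.vector_fieldsD(1)[OF Z, of b] and D0 = F.vector_fieldsD(1)[OF Z0, of b]
    have "vfield_quot Z (\<lambda>x. f x + g x) b = vfield_quot Z f b + vfield_quot Z g b"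
      "vfield_quot Z (\<lambda>x. f x * g x) b = vfield_quot Z f b * g b + f b * vfield_quot Z g b"
      if f: "fsmth UNIV f" and g: "fsmth UNIV g" for f g
    proof -
      have "fps_X * vfield_quot Z (\<lambda>x. f x + g x) b
          = fps_X * vfield_quot Z f b + fps_X * vfield_quot Z g b"
        using F.tangentD(2)[OF D f g] F.tangentD(2)[OF D0 f g] by (simp add: X algebra_simps)
      then show "vfield_quot Z (\<lambda>x. f x + g x) b = vfield_quot Z f b + vfield_quot Z g b"
        by (simp only: fps_X_cancel distrib_left [symmetric])
      have "fps_X * vfield_quot Z (\<lambda>x. f x * g x) b
          = (fps_X * vfield_quot Z f b) * g b + f b * (fps_X * vfield_quot Z g b)"
        using F.tangentD(3)[OF D f g] F.tangentD(3)[OF D0 f g] by (simp add: X algebra_simps)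
      also have "\<dots> = fps_X * (vfield_quot Z f b * g b + f b * vfield_quot Z g b)"
        by (simp only: distrib_left ac_simps)
      finally show "vfield_quot Z (\<lambda>x. f x * g x) b = vfield_quot Z f b * g b + f b * vfield_quot Z g b"
        by (rule fps_X_cancel)
    qed
    moreover have "vfield_quot Z (\<lambda>x. c * f x) b = c * vfield_quot Z f b" if f: "fsmth UNIV f" for c f
    proof (rule fps_X_cancel)
      have "fps_X * vfield_quot Z (\<lambda>x. c * f x) b = c * (fps_X * vfield_quot Z f b)"
        using F.tangentD(4)[OF D f] F.tangentD(4)[OF D0 f] by (simp add: X algebra_simps)
      then show "fps_X * vfield_quot Z (\<lambda>x. c * f x) b = fps_X * (c * vfield_quot Z f b)"
        by (simp only: ac_simps)
    qed
    moreover have "vfield_quot Z f b = 0" if "\<not> fsmth UNIV f" for f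
      using that F.tangentD(1)[OF D that] by (simp add: vfield_quot_def pull_vfield_notin)
    ultimately show ?thesis by (simp add: tangent_def)
  qed
  moreover have "fsmth UNIV (vfield_quot Z f)" if "fsmth UNIV f" for f
    unfolding vfield_quot_def
    by (intro formal_shift F.diff open_UNIV F.vector_fieldsD(2)[OF Z that] F.vector_fieldsD(2)[OF Z0 that])
  ultimately show ?thesis by (simp add: vector_fields_def)
qed

lemma vfield_scale:
  assumes Z: "Z \<in> vector_fields fsmth"
  shows "(\<lambda>g b. c * Z g b) \<in> vector_fields fsmth"
proof -
  have "(\<lambda>f. c * Z f b) \<in> tangent fsmth b" for b
    using F.tangentD[OF F.vector_fieldsD(1)[OF Z, of b]] unfolding tangent_def
    by (simp add: algebra_simps)
  then show ?thesis
    using F.cmult[OF open_UNIV F.vector_fieldsD(2)[OF Z]] by (simp add: vector_fields_def)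
qed

end

section \<open>Power series of vectors\<close>

context module
begin

lemma fps_smul_const_left: "fps_smul scale (fps_const c) x $ n = scale c (x $ n)"
proof -
  have "(\<Sum>i\<le>n. scale (fps_const c $ i) (x $ (n - i))) = (\<Sum>i\<in>{0}. scale (fps_const c $ i) (x $ (n - i)))"
    by (rule sum.mono_neutral_right) auto
  then show ?thesis by (simp add: fps_smul_def)
qed

lemma fps_smul_const_right: "fps_smul scale f (fps_const v) $ n = scale (f $ n) v"
proof -
  have "(\<Sum>i\<le>n. scale (f $ i) (fps_const v $ (n - i))) = (\<Sum>i\<in>{n}. scale (f $ i) (fps_const v $ (n - i)))"
    by (rule sum.mono_neutral_right) auto
  then show ?thesis by (simp add: fps_smul_def)
qed

lemma fps_smul_nth_0: "fps_smul scale f x $ 0 = scale (f $ 0) (x $ 0)"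
  by (simp add: fps_smul_def)

lemma fps_smul_X: "fps_smul scale fps_X x $ n = (if n = 0 then 0 else x $ (n - 1))"
proof (cases n)
  case (Suc m)
  have "(\<Sum>i\<le>n. scale (fps_X $ i) (x $ (n - i))) = (\<Sum>i\<in>{1}. scale (fps_X $ i) (x $ (n - i)))"
    using Suc by (intro sum.mono_neutral_right) auto
  then show ?thesis using Suc by (simp add: fps_smul_def)
qed (simp add: fps_smul_def)

text \<open>The counterpart of \<open>fps_split\<close> for series of vectors, on which
  \<open>u\<close> acts through \<open>fps_smul\<close>.\<close>

lemma fps_smul_split: "x = fps_const (x $ 0) + fps_smul scale fps_X (fps_shift 1 x)"
proof (rule fps_ext)
  fix n show "x $ n = (fps_const (x $ 0) + fps_smul scale fps_X (fps_shift 1 x)) $ n"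
    by (cases n) (simp_all add: fps_smul_X)
qed

lemma fps_smul_const_const: "fps_smul scale (fps_const c) (fps_const v) = fps_const (scale c v)"
  by (rule fps_ext) (simp add: fps_smul_const_left)

end

section \<open>Bundles pulled back from \<open>B\<close>\<close>

lemma pull_bundle_simps [simp]:
  "smul (pull_bundle H) = fps_smul (smul H)"
  "fibre (pull_bundle H) b = {x. \<forall>n. x $ n \<in> fibre H b}"
  "frames (pull_bundle H) = {(U, r, \<lambda>i b. fps_const (e i b)) | U r e. (U, r, e) \<in> frames H}"
  by (simp_all add: pull_bundle_def)

text \<open>Both bundle properties are assumptions: the one for \<open>H\<close> will come from the
  splitting over \<open>B\<close>, the one for \<open>pull_bundle H\<close> from the family
  itself.\<close>

locale pulled_bundle = formal_disk A +
  B: sheaf_bundle "smooth A" H + Q: sheaf_bundle "formal_smooth A" "pull_bundle H"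
  for A :: "('b::topological_space, 'e::euclidean_space) atlas"
    and H :: "('b, 'k::real_normed_field, 'h::ab_group_add) vbundle"
begin

lemma bundle_at_0_pull: "bundle_at_0 (pull_bundle H) = H"
proof -
  have "(\<lambda>x. x $ 0) ` {x. \<forall>n. x $ n \<in> fibre H b} = fibre H b" for b
  proof
    show "fibre H b \<subseteq> (\<lambda>x. x $ 0) ` {x. \<forall>n. x $ n \<in> fibre H b}"
      using B.fibre_0 by (auto intro!: image_eqI[of _ _ "fps_const x" for x])
  qed auto
  moreover have "{(U, r, \<lambda>i b. e i b $ 0) | U r e. (U, r, e) \<in> frames (pull_bundle H)} = frames H"
    by force
  ultimately show ?thesis
    by (simp add: bundle_at_0_def B.fps_smul_const_const)
qed

text \<open>Frames of the pulled back bundle are constant in \<open>u\<close>, so frame expansions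
  compare coefficient by coefficient: formal sections are power series of sections over
  \<open>B\<close>.\<close>

lemma section_pull_iff:
  "section_on fsmth (pull_bundle H) W s \<longleftrightarrow> (\<forall>n. section_on smth H W (\<lambda>b. s b $ n))"
proof
  assume s: "section_on fsmth (pull_bundle H) W s"
  show "\<forall>n. section_on smth H W (\<lambda>b. s b $ n)"
  proof (intro allI B.section_onI)
    fix n b assume "b \<in> W"
    then show "s b $ n \<in> fibre H b" using section_on_fibre[OF s] by simp
  next
    fix n U r e assume "(U, r, e) \<in> frames H"
    then have "(U, r, \<lambda>i b. fps_const (e i b)) \<in> frames (pull_bundle H)" by auto
    from Q.section_onE[OF s this] obtain c where c: "\<And>i. i < r \<Longrightarrow> fsmth (W \<inter> U) (c i)"
      "\<And>b. b \<in> W \<inter> U \<Longrightarrow> s b = (\<Sum>i<r. smul (pull_bundle H) (c i b) (fps_const (e i b)))"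
      by blast
    show "\<exists>c. (\<forall>i<r. smth (W \<inter> U) (c i)) \<and> (\<forall>b\<in>W \<inter> U. s b $ n = (\<Sum>i<r. smul H (c i b) (e i b)))"
      using c by (intro exI[of _ "\<lambda>i b. c i b $ n"])
        (simp add: formal_nth fps_sum_nth B.fps_smul_const_right)
  qed
next
  assume s: "\<forall>n. section_on smth H W (\<lambda>b. s b $ n)"
  show "section_on fsmth (pull_bundle H) W s"
  proof (rule Q.section_onI)
    fix b assume "b \<in> W"
    then show "s b \<in> fibre (pull_bundle H) b"
      using section_on_fibre[OF spec[OF s]] by simp
  next
    fix U r e' assume "(U, r, e') \<in> frames (pull_bundle H)"
    then obtain e where e: "(U, r, e) \<in> frames H" "e' = (\<lambda>i b. fps_const (e i b))" by auto
    have "\<exists>c. (\<forall>i<r. smth (W \<inter> U) (c i)) \<and> (\<forall>b\<in>W \<inter> U. s b $ n = (\<Sum>i<r. smul H (c i b) (e i b)))" for n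
      using B.section_onE[OF spec[OF s] e(1)] by metis
    \<comment> \<open>Coefficient functions are chosen for each \<open>n\<close> separately and
      become the coefficients of a single power series.\<close>
    then obtain c where c: "\<And>n i. i < r \<Longrightarrow> smth (W \<inter> U) (c n i)"
      "\<And>n b. b \<in> W \<inter> U \<Longrightarrow> s b $ n = (\<Sum>i<r. smul H (c n i b) (e i b))"
      by metis
    show "\<exists>c. (\<forall>i<r. fsmth (W \<inter> U) (c i)) \<and>
        (\<forall>b\<in>W \<inter> U. s b = (\<Sum>i<r. smul (pull_bundle H) (c i b) (e' i b)))"
      using c by (intro exI[of _ "\<lambda>i b. Abs_fps (\<lambda>n. c n i b)"])
        (simp add: formal_smooth_def fps_eq_iff fps_sum_nth B.fps_smul_const_right e(2))
  qed
qed

lemma sections_nth: "s \<in> sections fsmth (pull_bundle H) \<Longrightarrow> (\<lambda>b. s b $ n) \<in> sections smth H"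
  by (simp add: sections_iff section_pull_iff)

lemma section_const: "section_on smth H W s \<Longrightarrow> section_on fsmth (pull_bundle H) W (\<lambda>b. fps_const (s b))"
  unfolding section_pull_iff using B.section_zero by (intro allI) (case_tac "n = 0"; simp)

lemma sections_const: "s \<in> sections smth H \<Longrightarrow> (\<lambda>b. fps_const (s b)) \<in> sections fsmth (pull_bundle H)"
  by (simp add: sections_iff section_const)

lemma sections_shift:
  "s \<in> sections fsmth (pull_bundle H) \<Longrightarrow> (\<lambda>b. fps_shift m (s b)) \<in> sections fsmth (pull_bundle H)"
  by (simp add: sections_iff section_pull_iff)

end

text \<open>An equality of operators is required because the bracket will be an argument of a
  connection. Off the function ring both iterated terms are values at the zero function, which
  derivations kill.\<close>

lemma (in formal_disk) pull_vfield_bracket: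
  assumes Z: "Z \<in> vector_fields smth" and W: "W \<in> vector_fields smth"
  shows "pull_vfield A (bracket Z W) = bracket (pull_vfield A Z) (pull_vfield A W)"
proof (intro ext)
  fix f b
  show "pull_vfield A (bracket Z W) f b = bracket (pull_vfield A Z) (pull_vfield A W) f b"
  proof (cases "fsmth UNIV f")
    case True
    then show ?thesis
      using F.vector_fieldsD(2)[OF pull_vfield[OF Z] True] F.vector_fieldsD(2)[OF pull_vfield[OF W] True]
      by (simp add: fps_eq_iff bracket_def pull_vfield_nth)
  next
    case False
    then have "pull_vfield A Z f = (\<lambda>_. 0)" "pull_vfield A W f = (\<lambda>_. 0)"
      by (simp_all add: pull_vfield_notin fun_eq_iff)
    then show ?thesis
      using False F.tangent_const[OF F.vector_fieldsD(1)[OF pull_vfield[OF Z]], where c = 0]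
        F.tangent_const[OF F.vector_fieldsD(1)[OF pull_vfield[OF W]], where c = 0]
      by (simp add: pull_vfield_notin bracket_def)
  qed
qed

section \<open>Connections at \<open>u = 0\<close>\<close>

locale formal_connection = pulled_bundle A H
  for A :: "('b::topological_space, 'e::euclidean_space) atlas"
    and H :: "('b, 'k::real_normed_field, 'h::ab_group_add) vbundle" +
  fixes nab :: "('b, 'k fps, 'h fps) conn"
  assumes flat: "flat_connection fsmth (vector_fields fsmth) (pull_bundle H) nab"
begin

lemma conn: "connection fsmth (vector_fields fsmth) (pull_bundle H) nab"
  using flat by (simp add: flat_connection_def)

lemmas connD = F.connectionD[OF conn, unfolded pull_bundle_simps]

text \<open>\<open>u\<close> is a constant for fields along \<open>B\<close>, so by the Leibniz rule
  the connection commutes with multiplication by \<open>u\<close>, and the part of \<open>t\<close>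
  divisible by \<open>u\<close> drops out.\<close>

lemma nab_nth_0:
  assumes Z: "Z \<in> vector_fields fsmth" and t: "t \<in> sections fsmth (pull_bundle H)"
  shows "nab Z t b $ 0 = nab Z (\<lambda>y. fps_const (t y $ 0)) b $ 0"
proof -
  note sh = sections_shift[OF t, of 1] and c = sections_const[OF sections_nth[OF t], of 0]
  have "(\<lambda>y. fps_smul (smul H) fps_X (fps_shift 1 (t y))) \<in> sections fsmth (pull_bundle H)"
    using Q.section_smul[OF open_UNIV F.const, of "\<lambda>y. fps_shift 1 (t y)" fps_X] sh
    by (simp add: sections_iff)
  from connD(4)[OF Z c this]
  have "nab Z t b = nab Z (\<lambda>y. fps_const (t y $ 0)) b
      + nab Z (\<lambda>y. fps_smul (smul H) fps_X (fps_shift 1 (t y))) b"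
    by (simp only: B.fps_smul_split [symmetric])
  moreover have "nab Z (\<lambda>y. fps_smul (smul H) fps_X (fps_shift 1 (t y))) b $ 0 = 0"
    using connD(5)[OF Z sh F.const[of UNIV fps_X]] F.tangent_const[OF F.vector_fieldsD(1)[OF Z]]
    by (simp add: B.fps_smul_nth_0)
  ultimately show ?thesis by simp
qed

lemma nab_vfield_nth_0:
  assumes Z: "Z \<in> vector_fields fsmth" and t: "t \<in> sections fsmth (pull_bundle H)"
  shows "nab Z t b $ 0 = nab (pull_vfield A (vfield_at_0 A Z)) t b $ 0"
proof -
  let ?Z0 = "pull_vfield A (vfield_at_0 A Z)"
  have Z0: "?Z0 \<in> vector_fields fsmth" by (intro pull_vfield vfield_at_0 Z)
  note q = vfield_quot[OF Z]
  \<comment> \<open>The two sides are equal as operators, at all arguments, and may therefore be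
    exchanged inside \<open>nab\<close>.\<close>
  have "Z = (\<lambda>g b. ?Z0 g b + fps_X * vfield_quot Z g b)"
    by (simp add: vfield_quot_X[OF Z])
  then have "nab Z t b = nab (\<lambda>g b. ?Z0 g b + fps_X * vfield_quot Z g b) t b"
    by (rule arg_cong[where f = "\<lambda>Z. nab Z t b"])
  also have "\<dots> = nab ?Z0 t b + fps_smul (smul H) fps_X (nab (vfield_quot Z) t b)"
    using connD(2)[OF Z0 t vfield_scale[OF q, of fps_X]] connD(3)[OF q t F.const[of UNIV fps_X]]
    by simp
  finally show ?thesis by (simp add: B.fps_smul_nth_0)
qed

lemma conn_at_0_pull:
  assumes "Z \<in> vector_fields smth" "t \<in> sections fsmth (pull_bundle H)"
  shows "nab (pull_vfield A Z) t b $ 0 = conn_at_0 A nab Z (\<lambda>y. t y $ 0) b"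
  using nab_nth_0[OF pull_vfield[OF assms(1)] assms(2)] by (simp add: conn_at_0_def)

lemma conn_at_0_reduction:
  assumes "Z \<in> vector_fields fsmth" "t \<in> sections fsmth (pull_bundle H)"
  shows "nab Z t b $ 0 = conn_at_0 A nab (vfield_at_0 A Z) (\<lambda>y. t y $ 0) b"
  using nab_vfield_nth_0[OF assms] conn_at_0_pull[OF vfield_at_0[OF assms(1)] assms(2)] by simp

lemma conn_at_0_section:
  assumes Z: "Z \<in> vector_fields smth" and s: "s \<in> sections smth H"
  shows "conn_at_0 A nab Z s \<in> sections smth H"
  using sections_nth[OF connD(1)[OF pull_vfield[OF Z] sections_const[OF s]], of 0]
  by (simp add: conn_at_0_def[abs_def])

lemma conn_at_0_connection: "connection smth (vector_fields smth) H (conn_at_0 A nab)"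
  unfolding connection_def
proof (intro conjI ballI allI impI)
  fix Z s assume Z: "Z \<in> vector_fields smth" and s: "s \<in> sections smth H"
  note Zp = pull_vfield[OF Z] and sc = sections_const[OF s]
  show "conn_at_0 A nab Z s \<in> sections smth H" using Z s by (rule conn_at_0_section)
  show "conn_at_0 A nab (\<lambda>g b. Z g b + Z' g b) s = (\<lambda>b. conn_at_0 A nab Z s b + conn_at_0 A nab Z' s b)"
    if Z': "Z' \<in> vector_fields smth" for Z'
  proof -
    have "pull_vfield A (\<lambda>g b. Z g b + Z' g b) = (\<lambda>g b. pull_vfield A Z g b + pull_vfield A Z' g b)"
      by (auto simp: fun_eq_iff pull_vfield_def pull_vec_def fps_eq_iff)
    then show ?thesis
      using connD(2)[OF Zp sc pull_vfield[OF Z']] by (simp add: conn_at_0_def[abs_def])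
  qed
  show "conn_at_0 A nab Z (\<lambda>b. s b + t b) = (\<lambda>b. conn_at_0 A nab Z s b + conn_at_0 A nab Z t b)"
    if t: "t \<in> sections smth H" for t
    using connD(4)[OF Zp sc sections_const[OF t]]
    by (simp add: conn_at_0_def[abs_def])
  fix f assume f: "smth UNIV f"
  show "conn_at_0 A nab (\<lambda>g b. f b * Z g b) s = (\<lambda>b. smul H (f b) (conn_at_0 A nab Z s b))"
  proof -
    have "pull_vfield A (\<lambda>g b. f b * Z g b) = (\<lambda>g b. fps_const (f b) * pull_vfield A Z g b)"
      by (auto simp: fun_eq_iff pull_vfield_def pull_vec_def fps_eq_iff)
    then show ?thesis
      using connD(3)[OF Zp sc formal_const[OF f]]
      by (simp add: conn_at_0_def[abs_def] B.fps_smul_nth_0)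
  qed
  show "conn_at_0 A nab Z (\<lambda>b. smul H (f b) (s b))
      = (\<lambda>b. smul H (Z f b) (s b) + smul H (f b) (conn_at_0 A nab Z s b))"
    using connD(5)[OF Zp sc formal_const[OF f]]
    by (simp add: conn_at_0_def[abs_def] B.fps_smul_nth_0 B.fps_smul_const_const
        pull_vfield_nth[OF formal_const[OF f]])
qed

lemma conn_at_0_flat: "flat_connection smth (vector_fields smth) H (conn_at_0 A nab)"
  unfolding flat_connection_def
proof (intro conjI ballI allI conn_at_0_connection)
  fix Z W s b assume Z: "Z \<in> vector_fields smth" and W: "W \<in> vector_fields smth" and s: "s \<in> sections smth H"
  note sc = sections_const[OF s]
  \<comment> \<open>The inner derivative of a constant section need not be constant;
    \<open>conn_at_0_pull\<close> allows it to be replaced by its reduction.\<close>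
  have "nab (pull_vfield A Z) (nab (pull_vfield A W) (\<lambda>y. fps_const (s y))) b $ 0
      = conn_at_0 A nab Z (conn_at_0 A nab W s) b"
    if "Z \<in> vector_fields smth" "W \<in> vector_fields smth" for Z W
    using conn_at_0_pull[OF that(1) connD(1)[OF pull_vfield[OF that(2)] sc]]
    by (simp add: conn_at_0_def[abs_def])
  from this[OF Z W] this[OF W Z] show "conn_at_0 A nab Z (conn_at_0 A nab W s) b
      - conn_at_0 A nab W (conn_at_0 A nab Z s) b - conn_at_0 A nab (bracket Z W) s b = 0"
    using arg_cong[where f = "\<lambda>x. x $ 0", OF F.flat_connection_curvature[OF flat pull_vfield[OF Z] pull_vfield[OF W] sc, of b]]
    by (simp add: pull_vfield_bracket[OF Z W, symmetric]) (simp add: conn_at_0_def)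
qed

end

section \<open>Ranks of two spaces in duality\<close>

lemma linear_on_0:
  assumes "linear_on s F t \<phi>" "(0::'h::ab_group_add) \<in> F" shows "\<phi> 0 = (0::'g::ab_group_add)"
  using linear_onD(1)[OF assms(1) assms(2) assms(2)] by simp

context module
begin

lemma linear_on_sum:
  assumes "linear_on scale F t \<phi>" "subspace F" "\<And>i. i \<in> I \<Longrightarrow> v i \<in> F"
  shows "\<phi> (\<Sum>i\<in>I. scale (c i) (v i)) = (\<Sum>i\<in>I. t (c i) (\<phi> (v i)))"
  using assms(3)
proof (induction I rule: infinite_finite_induct)
  case (insert i I)
  then show ?case
    using linear_onD[OF assms(1)] assms(2) by (simp add: subspace_sum subspace_scale)
qed (use linear_on_0[OF assms(1)] subspace_0[OF assms(2)] in auto)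

text \<open>Uniqueness in \<open>is_basis\<close> concerns coefficient functions that vanish from
  \<open>r\<close> on, so \<open>c\<close> is cut off there before it is compared with zero.\<close>

lemma is_basis_zero:
  assumes "is_basis scale F r e" "0 \<in> F" "(\<Sum>i<r. scale (c i) (e i)) = 0" "i < r"
  shows "c i = 0"
proof -
  let ?c = "\<lambda>i. if i < r then c i else 0"
  let ?Q = "\<lambda>c. (\<forall>i\<ge>r. c i = 0) \<and> 0 = (\<Sum>i<r. scale (c i) (e i))"
  have "\<forall>x\<in>F. \<exists>!c. (\<forall>i\<ge>r. c i = 0) \<and> x = (\<Sum>i<r. scale (c i) (e i))"
    using assms(1) unfolding is_basis_def by (elim conjE)
  from bspec[OF this assms(2)] have uniq: "c' = c''" if "?Q c'" "?Q c''" for c' c''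
    using that by (elim ex1E) metis
  have "?c = (\<lambda>_. 0)"
    by (rule uniq) (use assms(3) in simp_all)
  then show ?thesis using assms(4) by (simp add: fun_eq_iff split: if_splits)
qed

lemma is_basis_expand:
  assumes "is_basis scale F r e" "x \<in> F"
  obtains c where "x = (\<Sum>i<r. scale (c i) (e i))"
  using assms unfolding is_basis_def by blast

end

context vector_space
begin

text \<open>A bound for indexed families obtained from the one for sets: a repetition
  \<open>v i = v j\<close> would give a nontrivial relation, so the family has as many members as
  its image.\<close>

lemma independent_family_le:
  assumes "\<And>j. j < q \<Longrightarrow> v j \<in> span (e ` {..<r})"
    and indep: "\<And>c. (\<Sum>j<q. scale (c j) (v j)) = 0 \<Longrightarrow> \<forall>j<q. c j = 0"
  shows "q \<le> (r::nat)"
proof -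
  have inj: "inj_on v {..<q}"
  proof (rule inj_onI, rule ccontr)
    fix i j assume ij: "i \<in> {..<q}" "j \<in> {..<q}" "v i = v j" "i \<noteq> j"
    let ?c = "\<lambda>k. (if k = i then 1 else 0) - (if k = j then 1 else 0)"
    have "(\<Sum>k<q. scale (?c k) (v k))
        = (\<Sum>k<q. if k = i then v k else 0) - (\<Sum>k<q. if k = j then v k else 0)"
      unfolding sum_subtractf[symmetric] by (rule sum.cong) auto
    also have "\<dots> = 0" using ij by simp
    finally show False using indep[of ?c] ij by force
  qed
  have "independent (v ` {..<q})"
  proof -
    have "u w = 0" if "(\<Sum>w\<in>v ` {..<q}. scale (u w) w) = 0" "w \<in> v ` {..<q}" for u w
      using indep[of "\<lambda>j. u (v j)"] that by (auto simp: sum.reindex[OF inj])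
    then show ?thesis
      unfolding dependent_finite[OF finite_imageI[OF finite_lessThan]] by blast
  qed
  then have "card (v ` {..<q}) \<le> card (e ` {..<r})"
    using assms(1) independent_span_bound[of "e ` {..<r}" "v ` {..<q}"] by auto
  also have "\<dots> \<le> r" using card_image_le[of "{..<r}" e] by simp
  finally show ?thesis by (simp add: card_image[OF inj])
qed

text \<open>A basis of \<open>F\<close> turns functionals on \<open>F\<close> into vectors:
  \<open>?T y\<close> has the coordinates \<open>\<beta> (e i) y\<close>. Non-degeneracy makes
  \<open>?T\<close> injective on \<open>G\<close>, so the \<open>q\<close> images of a basis of
  \<open>G\<close> are independent in the span of \<open>r\<close> vectors.\<close>

lemma pairing_rank_le:
  fixes e f :: "nat \<Rightarrow> 'b"
  assumes e: "is_basis scale F r e" "subspace F" and f: "is_basis scale G q f" "subspace G"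
    and lin: "\<And>x. x \<in> F \<Longrightarrow> linear_on scale G (*) (\<beta> x)"
      "\<And>y. y \<in> G \<Longrightarrow> linear_on scale F (*) (\<lambda>x. \<beta> x y)"
    and nondeg: "\<And>y. y \<in> G \<Longrightarrow> (\<And>x. x \<in> F \<Longrightarrow> \<beta> x y = 0) \<Longrightarrow> y = 0"
  shows "q \<le> r"
proof (rule independent_family_le)
  let ?T = "\<lambda>y. \<Sum>i<r. scale (\<beta> (e i) y) (e i)"
  have eF: "e i \<in> F" if "i < r" for i using e(1) that by (simp add: is_basis_def)
  have fG: "f j \<in> G" if "j < q" for j using f(1) that by (simp add: is_basis_def)
  show "?T (f j) \<in> span (e ` {..<r})" for j
    by (intro span_sum span_scale span_base) simp
  fix c assume 0: "(\<Sum>j<q. scale (c j) (?T (f j))) = 0"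
  define y where "y = (\<Sum>j<q. scale (c j) (f j))"
  have y: "y \<in> G" unfolding y_def using f(2) fG by (intro subspace_sum subspace_scale) auto
  have "(\<Sum>j<q. scale (c j) (?T (f j))) = (\<Sum>j<q. \<Sum>i<r. scale (c j * \<beta> (e i) (f j)) (e i))"
    by (simp add: scale_sum_right)
  also have "\<dots> = (\<Sum>i<r. \<Sum>j<q. scale (c j * \<beta> (e i) (f j)) (e i))"
    by (rule sum.swap)
  also have "\<dots> = ?T y"
    using linear_on_sum[OF lin(1)[OF eF] f(2), of _ "{..<q}" f c] fG
    by (intro sum.cong) (simp_all add: y_def scale_sum_left)
  finally have *: "\<beta> (e i) y = 0" if "i < r" for i
    using 0 is_basis_zero[OF e(1) subspace_0[OF e(2)], of "\<lambda>i. \<beta> (e i) y"] that by simp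
  have "\<beta> x y = 0" if x: "x \<in> F" for x
  proof -
    obtain d where "x = (\<Sum>i<r. scale (d i) (e i))" by (rule is_basis_expand[OF e(1) x])
    then show ?thesis
      using linear_on_sum[OF lin(2)[OF y] e(2), of "{..<r}" e d] eF * by simp
  qed
  then have "y = 0" by (rule nondeg[OF y])
  then show "\<forall>j<q. c j = 0"
    using is_basis_zero[OF f(1) subspace_0[OF f(2)]] by (simp add: y_def)
qed

end

locale field_legendre_bundle = legendre_bundle \<O> V L
  for \<O> :: "('b::topological_space, 'k::field) sheaf" and V
    and L :: "('b, 'k, 'h::ab_group_add, 'p) legendre"
begin

lemma pairing_eq_0:
  assumes "x \<in> fibre H b" "\<And>y. y \<in> fibre H b \<Longrightarrow> pairing L b y x = 0"
  shows "x = 0"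
proof -
  have "\<exists>!x. x \<in> fibre H b \<and> (\<forall>y \<in> fibre H b. pairing L b x y = 0)"
    using nondegenerate[unfolded nondegenerate_def, rule_format, of b "\<lambda>_. 0"]
    by (simp add: linear_on_def)
  moreover have "pairing L b 0 y = 0" if "y \<in> fibre H b" for y
    using pairing_smul(2)[OF that H.fibre_0, of 0] by simp
  moreover have "pairing L b x y = 0" if "y \<in> fibre H b" for y
    using assms that pairing_sym[OF assms(1) that] by simp
  ultimately show ?thesis using assms(1) H.fibre_0 by blast
qed

lemma frames_rank:
  assumes "(U, r, e) \<in> frames P" "(W, q, f) \<in> frames M" "U \<inter> W \<noteq> {}"
  shows "r = q"
proof (rule antisym)
  obtain b where b: "b \<in> U" "b \<in> W" using assms(3) by blast
  interpret VS: vector_space "smul H"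
    using H.module_axioms by (simp add: vector_space_def module_def)
  note e = P.frame_basis[OF assms(1) b(1), unfolded smul_eq] P.subspace_fibre[unfolded smul_eq, of b]
    and f = M.frame_basis[OF assms(2) b(2), unfolded smul_eq] M.subspace_fibre[unfolded smul_eq, of b]
  have lin: "linear_on (smul H) (fibre M b) (*) (pairing L b x)"
    "linear_on (smul H) (fibre M b) (*) (\<lambda>y. pairing L b y x)" if "x \<in> fibre P b" for x
    using pairing_linear[OF P_fibre_H[OF that]] M_fibre_H by (auto simp: linear_on_def)
  have lin': "linear_on (smul H) (fibre P b) (*) (pairing L b x)"
    "linear_on (smul H) (fibre P b) (*) (\<lambda>y. pairing L b y x)" if "x \<in> fibre M b" for x
    using pairing_linear[OF M_fibre_H[OF that]] P_fibre_H by (auto simp: linear_on_def)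
  have "pairing L b y x = 0"
    if "x \<in> fibre M b" "\<And>y. y \<in> fibre P b \<Longrightarrow> pairing L b y x = 0" "y \<in> fibre H b" for x y
    using that pairing_add(2)[of x b "proj_plus L b y" "proj_minus L b y"]
    by (simp add: proj_fibre proj_sum P_fibre_H M_fibre_H pairing_MM)
  then have nd: "x = 0" if "x \<in> fibre M b" "\<And>y. y \<in> fibre P b \<Longrightarrow> pairing L b y x = 0" for x
    using that by (intro pairing_eq_0[OF M_fibre_H]) auto
  show "q \<le> r"
    by (rule VS.pairing_rank_le[OF e f lin(1) lin'(2)]) (auto intro: nd)
  have "pairing L b y x = 0"
    if "x \<in> fibre P b" "\<And>y. y \<in> fibre M b \<Longrightarrow> pairing L b y x = 0" "y \<in> fibre H b" for x y
    using that pairing_add(2)[of x b "proj_plus L b y" "proj_minus L b y"]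
    by (simp add: proj_fibre proj_sum P_fibre_H M_fibre_H pairing_PP)
  then have nd': "x = 0" if "x \<in> fibre P b" "\<And>y. y \<in> fibre M b \<Longrightarrow> pairing L b y x = 0" for x
    using that by (intro pairing_eq_0[OF P_fibre_H]) auto
  show "r \<le> q"
    by (rule VS.pairing_rank_le[OF f e lin'(1) lin(2)]) (auto intro: nd')
qed

end

lemma (in sheaf_bundle) tangent_iso_cong:
  assumes "tangent_iso \<O> H \<tau>" and eq: "\<And>b x. x \<in> fibre H b \<Longrightarrow> \<tau>' b x = \<tau> b x"
  shows "tangent_iso \<O> H \<tau>'"
proof -
  have "bij_betw (\<tau>' b) (fibre H b) (tangent \<O> b)" for b
    using assms(1) bij_betw_cong[of "fibre H b" "\<tau>' b" "\<tau> b"] eq by (simp add: tangent_iso_def)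
  moreover have "linear_on (smul H) (fibre H b) (*) (\<lambda>x. \<tau>' b x f)" for b f
    using assms(1) by (simp add: tangent_iso_def linear_on_def eq fibre_add fibre_scale)
  moreover have "section_on \<O> H W s \<longleftrightarrow> (\<forall>f. \<O> UNIV f \<longrightarrow> \<O> W (\<lambda>b. \<tau>' b (s b) f))"
    if W: "open W" "\<forall>b\<in>W. s b \<in> fibre H b" for W s
  proof -
    have "\<O> W (\<lambda>b. \<tau>' b (s b) f) \<longleftrightarrow> \<O> W (\<lambda>b. \<tau> b (s b) f)" for f
      using W(2) eq by (intro iffI; elim cong[OF W(1), rotated]) simp_all
    then show ?thesis using assms(1) W by (simp add: tangent_iso_def)
  qed
  ultimately show ?thesis by (simp add: tangent_iso_def)
qed

lemma (in sheaf_bundle) cotangent_iso_cong: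
  assumes "cotangent_iso \<O> H \<tau>" and eq: "\<And>b x. x \<in> fibre H b \<Longrightarrow> \<tau>' b x = \<tau> b x"
  shows "cotangent_iso \<O> H \<tau>'"
proof -
  have "bij_betw (\<tau>' b) (fibre H b) (cotangent \<O> b)" for b
    using assms(1) bij_betw_cong[of "fibre H b" "\<tau>' b" "\<tau> b"] eq by (simp add: cotangent_iso_def)
  moreover have "linear_on (smul H) (fibre H b) (*) (\<lambda>x. \<tau>' b x D)" for b D
    using assms(1) by (simp add: cotangent_iso_def linear_on_def eq fibre_add fibre_scale)
  moreover have "section_on \<O> H W s \<longleftrightarrow> (\<forall>Z\<in>vector_fields \<O>. \<O> W (\<lambda>b. \<tau>' b (s b) (\<lambda>f. Z f b)))"
    if W: "open W" "\<forall>b\<in>W. s b \<in> fibre H b" for W s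
  proof -
    have "\<O> W (\<lambda>b. \<tau>' b (s b) (\<lambda>f. Z f b)) \<longleftrightarrow> \<O> W (\<lambda>b. \<tau> b (s b) (\<lambda>f. Z f b))" for Z
      using W(2) eq by (intro iffI; elim cong[OF W(1), rotated]) simp_all
    then show ?thesis using assms(1) W by (simp add: cotangent_iso_def)
  qed
  ultimately show ?thesis by (simp add: cotangent_iso_def)
qed

lemma vector_fields_subset_total:
  "vector_fields (formal_smooth A) \<subseteq> (total_vector_fields A :: ('b::topological_space, 'k::real_normed_field fps) vfield set)"
proof
  fix Z :: "('b, 'k fps) vfield" assume Z: "Z \<in> vector_fields (formal_smooth A)"
  then have "\<forall>b. (\<lambda>f. Z f b) \<in> tangent (formal_smooth A) b" by (simp add: vector_fields_def)
  then have "Z f b = 0" if "\<not> formal_smooth A UNIV f" for f b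
    using that by (simp add: tangent_def)
  then have "Z = (\<lambda>f b. if formal_smooth A UNIV f then Z f b + 0 * fps_deriv (f b) else 0)"
    by (simp add: fun_eq_iff)
  moreover have "formal_smooth A UNIV (\<lambda>_. 0 :: 'k fps)"
    by (auto simp: formal_smooth_def smooth_def Cinf_on_def o_def Ck_on_const)
  ultimately show "Z \<in> total_vector_fields A"
    unfolding total_vector_fields_def using Z
    by (intro CollectI exI[of _ Z] exI[of _ "\<lambda>_. 0"]) simp
qed

lemma two_dvd_one: "(2 :: 'k::real_normed_field) dvd 1" "(2 :: 'k fps) dvd 1"
proof -
  show "(2 :: 'k) dvd 1" by (rule dvdI[of _ _ "1 / 2"]) simp
  show "(2 :: 'k fps) dvd 1"
    by (rule dvdI[of _ _ "fps_const (1 / 2)"])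
      (simp add: fps_eq_iff numeral_fps_const del: fps_const_mult)
qed

lemma (in pulled_bundle) fps_const_fibre: "x \<in> fibre H b \<Longrightarrow> fps_const x \<in> fibre (pull_bundle H) b"
  by (auto simp: B.fibre_0)

locale legendre_reduction = formal_disk A
  for A :: "('b::topological_space, 'e::euclidean_space) atlas" +
  fixes L :: "('b, 'k::real_normed_field fps, 'h::ab_group_add fps, real fps) legendre"
    and H P M :: "('b, 'k, 'h) vbundle" and \<tau>p \<tau>m
  assumes splitting_base: "legendre_splitting smth H P M \<tau>p \<tau>m"
    and pulled [simp]: "hbundle L = pull_bundle H" "hplus L = pull_bundle P" "hminus L = pull_bundle M"
    and tau_plus: "x \<in> fibre (hplus L) b \<Longrightarrow> tau_plus L b x = pull_tau_plus A \<tau>p b x"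
    and tau_minus: "x \<in> fibre (hminus L) b \<Longrightarrow> tau_minus L b x = pull_tau_minus A \<tau>m b x"
    and legendre_formal: "legendre_structure fsmth (total_vector_fields A) L"
begin

sublocale FL: legendre_bundle fsmth "total_vector_fields A" L
  by unfold_locales (rule legendre_formal vector_fields_subset_total two_dvd_one)+

sublocale HB: pulled_bundle A H
  using splitting_base FL.H.vector_bundle
  by unfold_locales (simp_all add: legendre_splitting_def)

sublocale PB: formal_connection A P "nabla_plus L"
  using splitting_base FL.P.vector_bundle FL.flat_plus
  by unfold_locales (simp_all add: legendre_splitting_def)

sublocale MB: formal_connection A M "nabla_minus L"
  using splitting_base FL.M.vector_bundle FL.flat_minus
  by unfold_locales (simp_all add: legendre_splitting_def)

abbreviation "L0 \<equiv> legendre_at_0 A L"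

lemma at_0_simps [simp]:
  "hbundle L0 = H" "hplus L0 = P" "hminus L0 = M"
  "pairing L0 b x y = pairing L b (fps_const x) (fps_const y) $ 0"
  "nabla_plus L0 = conn_at_0 A (nabla_plus L)" "nabla_minus L0 = conn_at_0 A (nabla_minus L)"
  by (simp_all add: legendre_at_0_def HB.bundle_at_0_pull PB.bundle_at_0_pull MB.bundle_at_0_pull)

lemma tangent_iso_base: "tangent_iso smth P \<tau>p" and cotangent_iso_base: "cotangent_iso smth M \<tau>m"
  using splitting_base by (simp_all add: legendre_splitting_def)

lemma tau_plus_tangent: "x \<in> fibre P b \<Longrightarrow> \<tau>p b x \<in> tangent smth b"
  using tangent_iso_base by (auto simp: tangent_iso_def bij_betw_def)

lemma tau_plus_0: "\<tau>p b 0 f = 0"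
proof -
  have "linear_on (smul P) (fibre P b) (*) (\<lambda>x. \<tau>p b x f)"
    using tangent_iso_base by (simp add: tangent_iso_def)
  from linear_on_0[OF this PB.B.fibre_0] show ?thesis .
qed

lemma tau_plus_const:
  assumes "x \<in> fibre P b" shows "tau_plus L b (fps_const x) = pull_vec A (\<tau>p b x)"
proof -
  have "(\<Sum>i\<le>n. \<tau>p b (fps_const x $ i) (\<lambda>y. f y $ (n - i))) = \<tau>p b x (\<lambda>y. f y $ n)" for n f
  proof -
    have "(\<Sum>i\<le>n. \<tau>p b (fps_const x $ i) (\<lambda>y. f y $ (n - i)))
        = (\<Sum>i\<in>{0}. \<tau>p b (fps_const x $ i) (\<lambda>y. f y $ (n - i)))"
      by (rule sum.mono_neutral_right) (auto simp: tau_plus_0)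
    then show ?thesis by simp
  qed
  then show ?thesis
    using tau_plus[of "fps_const x" b] PB.fps_const_fibre[OF assms]
    by (simp add: pull_tau_plus_def pull_vec_def fun_eq_iff)
qed

lemma tau_plus_nth_0:
  assumes "x \<in> fibre (pull_bundle P) b" "fsmth UNIV f"
  shows "tau_plus L b x f $ 0 = \<tau>p b (x $ 0) (\<lambda>y. f y $ 0)"
  using assms by (simp add: tau_plus pull_tau_plus_def)

lemma vec_coeff_pull_vec: "D \<in> tangent smth b \<Longrightarrow> vec_coeff A (pull_vec A D) 0 = D"
  using S.tangentD(1) by (auto simp: fun_eq_iff vec_coeff_def pull_vec_def formal_const)

lemma tau_plus_at_0:
  assumes "x \<in> fibre P b" shows "tau_plus L0 b x = \<tau>p b x"
  using tau_plus_const[OF assms] vec_coeff_pull_vec[OF tau_plus_tangent[OF assms]]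
  by (simp add: legendre_at_0_def)

lemma tau_minus_at_0:
  assumes "x \<in> fibre M b" shows "tau_minus L0 b x = \<tau>m b x"
proof
  fix D
  show "tau_minus L0 b x D = \<tau>m b x D"
  proof (cases "D \<in> tangent smth b")
    case True
    then show ?thesis
      using tau_minus[of "fps_const x" b] MB.fps_const_fibre[OF assms] pull_vec_tangent[OF True]
      by (simp add: legendre_at_0_def pull_tau_minus_def vec_coeff_pull_vec)
  next
    case False
    have "\<tau>m b x \<in> cotangent smth b"
      using cotangent_iso_base assms by (auto simp: cotangent_iso_def bij_betw_def)
    then show ?thesis using False by (simp add: legendre_at_0_def cotangent_def)
  qed
qed

lemma splitting_at_0:
  "legendre_splitting smth (hbundle L0) (hplus L0) (hminus L0) (tau_plus L0) (tau_minus L0)"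
  using splitting_base PB.B.tangent_iso_cong[OF tangent_iso_base tau_plus_at_0]
    MB.B.cotangent_iso_cong[OF cotangent_iso_base tau_minus_at_0]
  by (simp add: legendre_splitting_def)

lemma pairing_nth_0:
  assumes x: "x \<in> fibre (pull_bundle H) b" and y: "y \<in> fibre (pull_bundle H) b"
  shows "pairing L b x y $ 0 = pairing L b (fps_const (x $ 0)) (fps_const (y $ 0)) $ 0"
proof -
  have c: "fps_const (z $ 0) \<in> fibre (hbundle L) b" and s: "fps_shift 1 z \<in> fibre (hbundle L) b"
    and Xs: "fps_smul (smul H) fps_X (fps_shift 1 z) \<in> fibre (hbundle L) b"
    if "z \<in> fibre (pull_bundle H) b" for z
  proof -
    show "fps_const (z $ 0) \<in> fibre (hbundle L) b" using that HB.fps_const_fibre by simp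
    show s: "fps_shift 1 z \<in> fibre (hbundle L) b" using that by simp
    show "fps_smul (smul H) fps_X (fps_shift 1 z) \<in> fibre (hbundle L) b"
      using FL.H.fibre_scale[OF s, of fps_X] by simp
  qed
  have y': "y \<in> fibre (hbundle L) b" using y by simp
  have "pairing L b x y = pairing L b (fps_const (x $ 0) + fps_smul (smul H) fps_X (fps_shift 1 x)) y"
    by (simp only: HB.B.fps_smul_split [symmetric])
  also have "\<dots> = pairing L b (fps_const (x $ 0)) y + fps_X * pairing L b (fps_shift 1 x) y"
    using FL.pairing_add(2)[OF y' c[OF x] Xs[OF x]]
      FL.pairing_smul(2)[OF y' s[OF x], of fps_X] by simp
  also have "pairing L b (fps_const (x $ 0)) y
      = pairing L b (fps_const (x $ 0)) (fps_const (y $ 0) + fps_smul (smul H) fps_X (fps_shift 1 y))"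
    by (simp only: HB.B.fps_smul_split [symmetric])
  also have "\<dots> = pairing L b (fps_const (x $ 0)) (fps_const (y $ 0))
      + fps_X * pairing L b (fps_const (x $ 0)) (fps_shift 1 y)"
    using FL.pairing_add(1)[OF c[OF x] c[OF y] Xs[OF y]]
      FL.pairing_smul(1)[OF c[OF x] s[OF y], of fps_X] by simp
  finally show ?thesis by simp
qed

lemma linear_on_pull:
  assumes "linear_on (smul H) (fibre H b) (*) \<mu>"
  shows "linear_on (smul (hbundle L)) (fibre (hbundle L) b) (*) (\<lambda>x. Abs_fps (\<lambda>n. \<mu> (x $ n)))"
  unfolding linear_on_def
proof (intro conjI ballI allI)
  fix x y assume "x \<in> fibre (hbundle L) b" "y \<in> fibre (hbundle L) b"
  then show "Abs_fps (\<lambda>n. \<mu> ((x + y) $ n)) = Abs_fps (\<lambda>n. \<mu> (x $ n)) + Abs_fps (\<lambda>n. \<mu> (y $ n))"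
    using linear_onD(1)[OF assms] by (simp add: fps_eq_iff)
next
  fix c x assume x: "x \<in> fibre (hbundle L) b"
  have "\<mu> (\<Sum>i\<le>n. smul H (c $ i) (x $ (n - i))) = (\<Sum>i\<le>n. c $ i * \<mu> (x $ (n - i)))" for n
    using x HB.B.linear_on_sum[OF assms HB.B.subspace_fibre, of "{..n}" "\<lambda>i. x $ (n - i)"] by simp
  then show "Abs_fps (\<lambda>n. \<mu> (smul (hbundle L) c x $ n)) = c * Abs_fps (\<lambda>n. \<mu> (x $ n))"
    by (simp add: fps_eq_iff fps_mult_nth fps_smul_def atLeast0AtMost)
qed

text \<open>
  Uniqueness: if the pairing with \<open>z\<close> vanishes at \<open>u = 0\<close>, then its quotient by \<open>u\<close> is represented
  by some \<open>w\<close>, so \<open>z = u w\<close> is constant and divisible by \<open>u\<close>.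
\<close>

lemma nondegenerate_at_0: "nondegenerate H (pairing L0)"
  unfolding nondegenerate_def
proof (intro allI impI)
  fix b \<mu> assume \<mu>: "linear_on (smul H) (fibre H b) (*) \<mu>"
  have ex1: "\<exists>!x. x \<in> fibre (hbundle L) b \<and> (\<forall>y\<in>fibre (hbundle L) b. pairing L b x y = \<nu> y)"
    if "linear_on (smul (hbundle L)) (fibre (hbundle L) b) (*) \<nu>" for \<nu>
    using FL.nondegenerate[unfolded nondegenerate_def] that by (elim allE impE)
  have ex: "\<exists>x. x \<in> fibre (hbundle L) b \<and> (\<forall>y\<in>fibre (hbundle L) b. pairing L b x y = \<nu> y)"
    if "linear_on (smul (hbundle L)) (fibre (hbundle L) b) (*) \<nu>" for \<nu>
    using ex1[OF that] by (rule ex1_implies_ex)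
  have uniq: "x = x'"
    if "linear_on (smul (hbundle L)) (fibre (hbundle L) b) (*) \<nu>"
      "x \<in> fibre (hbundle L) b" "x' \<in> fibre (hbundle L) b"
      "\<And>y. y \<in> fibre (hbundle L) b \<Longrightarrow> pairing L b x y = \<nu> y"
      "\<And>y. y \<in> fibre (hbundle L) b \<Longrightarrow> pairing L b x' y = \<nu> y" for \<nu> x x'
    using ex1[OF that(1)] that(2-5) by (elim ex1E) metis
  have cf: "fps_const x \<in> fibre (hbundle L) b" if "x \<in> fibre H b" for x
    using HB.fps_const_fibre[OF that] by simp
  obtain X where X: "X \<in> fibre (hbundle L) b"
    "\<And>y. y \<in> fibre (hbundle L) b \<Longrightarrow> pairing L b X y = Abs_fps (\<lambda>n. \<mu> (y $ n))"
    using ex[OF linear_on_pull[OF \<mu>]] by blast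
  have inj: "z = 0" if z: "z \<in> fibre H b" and 0: "\<And>y. y \<in> fibre H b \<Longrightarrow> pairing L0 b z y = 0" for z
  proof -
    let ?Z = "fps_const z" and ?\<nu> = "\<lambda>y. fps_shift 1 (pairing L b (fps_const z) y)"
    have X\<nu>: "fps_X * ?\<nu> y = pairing L b ?Z y" if "y \<in> fibre (hbundle L) b" for y
      using fps_split[of "pairing L b ?Z y"] pairing_nth_0[of ?Z b y] 0[of "y $ 0"] that cf[OF z] by simp
    have lin: "linear_on (smul (hbundle L)) (fibre (hbundle L) b) (*) (pairing L b ?Z)"
      by (rule FL.pairing_linear(1)[OF cf[OF z]])
    have "linear_on (smul (hbundle L)) (fibre (hbundle L) b) (*) ?\<nu>"
      unfolding linear_on_def
    proof (intro conjI ballI allI)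
      fix x y assume "x \<in> fibre (hbundle L) b" "y \<in> fibre (hbundle L) b"
      then show "?\<nu> (x + y) = ?\<nu> x + ?\<nu> y"
        using linear_onD(1)[OF lin] by (simp add: fps_eq_iff)
    next
      fix c x assume x: "x \<in> fibre (hbundle L) b"
      show "?\<nu> (smul (hbundle L) c x) = c * ?\<nu> x"
      proof (rule fps_X_cancel)
        have "fps_X * ?\<nu> (smul (hbundle L) c x) = c * (fps_X * ?\<nu> x)"
          unfolding X\<nu>[OF x] X\<nu>[OF FL.H.fibre_scale[OF x]] by (rule linear_onD(2)[OF lin x])
        then show "fps_X * ?\<nu> (smul (hbundle L) c x) = fps_X * (c * ?\<nu> x)"
          by (simp only: ac_simps)
      qed
    qed
    then obtain w where w: "w \<in> fibre (hbundle L) b"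
      "\<And>y. y \<in> fibre (hbundle L) b \<Longrightarrow> pairing L b w y = ?\<nu> y"
      using ex by blast
    have "?Z = smul (hbundle L) fps_X w"
    proof (rule uniq[OF lin cf[OF z] FL.H.fibre_scale[OF w(1)]])
      fix y assume y: "y \<in> fibre (hbundle L) b"
      show "pairing L b (smul (hbundle L) fps_X w) y = pairing L b ?Z y"
        by (simp only: FL.pairing_smul(2)[OF y w(1)] w(2)[OF y] X\<nu>[OF y])
    qed simp
    then have "?Z $ 0 = smul (hbundle L) fps_X w $ 0" by (rule arg_cong)
    then show "z = 0" by (simp add: HB.B.fps_smul_nth_0)
  qed
  show "\<exists>!x. x \<in> fibre H b \<and> (\<forall>y\<in>fibre H b. pairing L0 b x y = \<mu> y)"
  proof (rule ex1I[of _ "X $ 0"])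
    have "pairing L0 b (X $ 0) y = \<mu> y" if "y \<in> fibre H b" for y
      using X(1) X(2)[OF cf[OF that]] pairing_nth_0[of X b "fps_const y"] cf[OF that] by simp
    then show X0: "X $ 0 \<in> fibre H b \<and> (\<forall>y\<in>fibre H b. pairing L0 b (X $ 0) y = \<mu> y)"
      using X(1) by simp
    fix x assume x: "x \<in> fibre H b \<and> (\<forall>y\<in>fibre H b. pairing L0 b x y = \<mu> y)"
    have "x - X $ 0 = 0"
    proof (rule inj)
      show d: "x - X $ 0 \<in> fibre H b" using x X0 by (simp add: HB.B.fibre_diff)
      fix y assume y: "y \<in> fibre H b"
      have "pairing L b (fps_const x) (fps_const y)
          = pairing L b (fps_const (x - X $ 0)) (fps_const y) + pairing L b (fps_const (X $ 0)) (fps_const y)"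
        using FL.pairing_add(2)[OF cf[OF y] cf[OF d] cf, of "X $ 0"] X0 by simp
      then show "pairing L0 b (x - X $ 0) y = 0"
        using x X0 y by (auto simp del: fps_const_sub)
    qed
    then show "x = X $ 0" by simp
  qed
qed

lemma pairing_at_0: "legendre_pairing smth L0"
  unfolding legendre_pairing_def at_0_simps(1-3)
proof (intro conjI allI ballI nondegenerate_at_0)
  have c: "x \<in> fibre H b \<Longrightarrow> fps_const x \<in> fibre (hbundle L) b"
    "x \<in> fibre P b \<Longrightarrow> fps_const x \<in> fibre (hplus L) b"
    "x \<in> fibre M b \<Longrightarrow> fps_const x \<in> fibre (hminus L) b" for x b
    using HB.fps_const_fibre PB.fps_const_fibre MB.fps_const_fibre by simp_all
  show "bilinear_form smth H (pairing L0)"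
    unfolding bilinear_form_def
  proof (intro conjI allI ballI impI)
    fix b x assume x: "x \<in> fibre H b"
    note l = linear_onD[OF FL.pairing_linear(1)[OF c(1)[OF x]]]
      linear_onD[OF FL.pairing_linear(2)[OF c(1)[OF x]]]
    have "pairing L b (fps_const x) (fps_const (y + z)) = pairing L b (fps_const x) (fps_const y)
          + pairing L b (fps_const x) (fps_const z)"
      "pairing L b (fps_const (y + z)) (fps_const x) = pairing L b (fps_const y) (fps_const x)
          + pairing L b (fps_const z) (fps_const x)" if "y \<in> fibre H b" "z \<in> fibre H b" for y z
      using l(1)[OF c(1)[OF that(1)] c(1)[OF that(2)]] l(3)[OF c(1)[OF that(1)] c(1)[OF that(2)]]
      by simp_all
    moreover have "pairing L b (fps_const x) (fps_const (smul H k y)) = fps_const k * pairing L b (fps_const x) (fps_const y)"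
      "pairing L b (fps_const (smul H k y)) (fps_const x) = fps_const k * pairing L b (fps_const y) (fps_const x)"
      if "y \<in> fibre H b" for k y
      using l(2)[OF c(1)[OF that], of "fps_const k"] l(4)[OF c(1)[OF that], of "fps_const k"]
      by (simp_all add: HB.B.fps_smul_const_const)
    ultimately show "linear_on (smul H) (fibre H b) (*) (pairing L0 b x)"
      "linear_on (smul H) (fibre H b) (*) (\<lambda>y. pairing L0 b y x)"
      by (simp_all add: linear_on_def)
  next
    fix W s t assume "open W" "section_on smth H W s" "section_on smth H W t"
    then have "fsmth W (\<lambda>b. pairing L b (fps_const (s b)) (fps_const (t b)))"
      using HB.section_const by (intro FL.pairing_section) simp_all
    then show "smth W (\<lambda>b. pairing L0 b (s b) (t b))" by (simp add: formal_nth)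
  qed
  show "pairing L0 b x y = pairing L0 b y x" if "x \<in> fibre H b" "y \<in> fibre H b" for b x y
    using FL.pairing_sym[OF c(1) c(1), OF that] by simp
  show "pairing L0 b x y = 0" if "x \<in> fibre P b" "y \<in> fibre P b" for b x y
    using FL.pairing_PP[OF c(2) c(2), OF that] by simp
  show "pairing L0 b x y = 0" if "x \<in> fibre M b" "y \<in> fibre M b" for b x y
    using FL.pairing_MM[OF c(3) c(3), OF that] by simp
  show "pairing L0 b x \<alpha> = tau_minus L0 b \<alpha> (tau_plus L0 b x)"
    if x: "x \<in> fibre P b" and \<alpha>: "\<alpha> \<in> fibre M b" for b x \<alpha>
  proof -
    have "pairing L b (fps_const x) (fps_const \<alpha>) = tau_minus L b (fps_const \<alpha>) (tau_plus L b (fps_const x))"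
      using FL.pairing_conds[THEN conjunct2, THEN conjunct2, THEN conjunct2, THEN conjunct2, THEN conjunct2]
        c(2)[OF x] c(3)[OF \<alpha>] by blast
    then show ?thesis
      using tau_plus_const[OF x] tau_plus_at_0[OF x] tau_plus_tangent[OF x]
      by (simp add: legendre_at_0_def)
  qed
qed

lemma dual_at_0: "dual_connections smth (vector_fields smth) L0"
  unfolding dual_connections_def at_0_simps
proof (intro ballI allI)
  fix Z s \<alpha> b
  assume Z: "Z \<in> vector_fields smth" and s: "s \<in> sections smth P" and \<alpha>: "\<alpha> \<in> sections smth M"
  let ?Z = "pull_vfield A Z" and ?s = "\<lambda>y. fps_const (s y)" and ?\<alpha> = "\<lambda>y. fps_const (\<alpha> y)"
  note Zp = pull_vfield[OF Z]
  have sc: "?s \<in> sections fsmth (hplus L)" and \<alpha>c: "?\<alpha> \<in> sections fsmth (hminus L)"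
    using PB.sections_const[OF s] MB.sections_const[OF \<alpha>] by simp_all
  have F: "fsmth UNIV (\<lambda>x. pairing L x (?s x) (?\<alpha> x))"
    using FL.pairing_section[OF open_UNIV FL.P_section_H[OF open_UNIV] FL.M_section_H[OF open_UNIV]]
      sc \<alpha>c by (simp add: sections_iff)
  have n: "nabla_plus L ?Z ?s b \<in> fibre (hplus L) b" "nabla_minus L ?Z ?\<alpha> b \<in> fibre (hminus L) b"
    using sections_fibre[OF FL.plusD(1)[OF Zp sc]] sections_fibre[OF FL.minusD(1)[OF Zp \<alpha>c]] by simp_all
  have H: "nabla_plus L ?Z ?s b \<in> fibre (pull_bundle H) b" "nabla_minus L ?Z ?\<alpha> b \<in> fibre (pull_bundle H) b"
    "?s b \<in> fibre (pull_bundle H) b" "?\<alpha> b \<in> fibre (pull_bundle H) b"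
    using FL.P_fibre_H[OF n(1)] FL.M_fibre_H[OF n(2)] FL.P_fibre_H[OF sections_fibre[OF sc]]
      FL.M_fibre_H[OF sections_fibre[OF \<alpha>c]] by simp_all
  have "Z (\<lambda>x. pairing L x (?s x) (?\<alpha> x) $ 0) b = ?Z (\<lambda>x. pairing L x (?s x) (?\<alpha> x)) b $ 0"
    using pull_vfield_nth[OF F] by simp
  also have "\<dots> = pairing L b (nabla_plus L ?Z ?s b) (?\<alpha> b) $ 0 + pairing L b (?s b) (nabla_minus L ?Z ?\<alpha> b) $ 0"
    using FL.dual_Z[OF Zp sc \<alpha>c] by simp
  also have "\<dots> = pairing L b (fps_const (conn_at_0 A (nabla_plus L) Z s b)) (?\<alpha> b) $ 0
      + pairing L b (?s b) (fps_const (conn_at_0 A (nabla_minus L) Z \<alpha> b)) $ 0"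
    using pairing_nth_0[OF H(1,4)] pairing_nth_0[OF H(3,2)] by (simp add: conn_at_0_def)
  finally show "Z (\<lambda>x. pairing L x (?s x) (?\<alpha> x) $ 0) b = \<dots>" .
qed

lemma as_vector_field_at_0:
  assumes "s \<in> sections smth P"
  shows "as_vector_field L0 s = (\<lambda>f b. \<tau>p b (s b) f)" and "as_vector_field L0 s \<in> vector_fields smth"
proof -
  show eq: "as_vector_field L0 s = (\<lambda>f b. \<tau>p b (s b) f)"
    using tau_plus_at_0 sections_fibre[OF assms] by (simp add: as_vector_field_def)
  have "smth UNIV (\<lambda>b. \<tau>p b (s b) f)" if "smth UNIV f" for f
    using tangent_iso_base assms that sections_fibre[OF assms]
    unfolding tangent_iso_def sections_iff by blast
  then show "as_vector_field L0 s \<in> vector_fields smth"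
    using tau_plus_tangent[OF sections_fibre[OF assms]] by (simp add: eq vector_fields_def)
qed

lemma as_vector_field_const:
  assumes "s \<in> sections smth P"
  shows "as_vector_field L (\<lambda>y. fps_const (s y)) = pull_vfield A (as_vector_field L0 s)"
  using tau_plus_const[OF sections_fibre[OF assms]]
  unfolding as_vector_field_at_0(1)[OF assms] by (simp add: as_vector_field_def pull_vfield_def)

lemma torsion_free_at_0: "torsion_free smth L0"
  unfolding torsion_free_def at_0_simps
proof (intro ballI allI impI)
  fix s t f b assume s: "s \<in> sections smth P" and t: "t \<in> sections smth P" and f: "smth UNIV f"
  let ?f = "\<lambda>y. fps_const (f y)"
  have formal: "torsion_free fsmth L"
    using legendre_formal by (simp add: legendre_structure_def)
  have red: "as_vector_field L (nabla_plus L (as_vector_field L (\<lambda>y. fps_const (s y))) (\<lambda>y. fps_const (t y))) ?f b $ 0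
      = as_vector_field L0 (conn_at_0 A (nabla_plus L) (as_vector_field L0 s) t) f b"
    if s: "s \<in> sections smth P" and t: "t \<in> sections smth P" for s t
  proof -
    note Z = as_vector_field_at_0(2)[OF s] and sec = PB.sections_const[OF t]
    have "nabla_plus L (pull_vfield A (as_vector_field L0 s)) (\<lambda>y. fps_const (t y)) b \<in> fibre (pull_bundle P) b"
      by (rule sections_fibre[OF PB.connD(1)[OF pull_vfield[OF Z] sec]])
    from tau_plus_nth_0[OF this formal_const[OF f]] show ?thesis
      using as_vector_field_at_0(1)[OF PB.conn_at_0_section[OF Z t]] as_vector_field_const[OF s]
      by (simp add: conn_at_0_def as_vector_field_def)
  qed
  let ?s = "\<lambda>y. fps_const (s y)" and ?t = "\<lambda>y. fps_const (t y)"
  have "(as_vector_field L (nabla_plus L (as_vector_field L ?s) ?t) ?f b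
      - as_vector_field L (nabla_plus L (as_vector_field L ?t) ?s) ?f b) $ 0
      = bracket (as_vector_field L ?s) (as_vector_field L ?t) ?f b $ 0"
    using formal[unfolded torsion_free_def, rule_format, of ?s ?t ?f b]
      PB.sections_const[OF s] PB.sections_const[OF t] formal_const[OF f] by simp
  then have "as_vector_field L0 (conn_at_0 A (nabla_plus L) (as_vector_field L0 s) t) f b
      - as_vector_field L0 (conn_at_0 A (nabla_plus L) (as_vector_field L0 t) s) f b
      = bracket (as_vector_field L (\<lambda>y. fps_const (s y))) (as_vector_field L (\<lambda>y. fps_const (t y))) ?f b $ 0"
    by (simp add: red s t)
  also have "\<dots> = bracket (as_vector_field L0 s) (as_vector_field L0 t) f b"
    unfolding as_vector_field_const[OF s] as_vector_field_const[OF t]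
      pull_vfield_bracket[OF as_vector_field_at_0(2)[OF s] as_vector_field_at_0(2)[OF t], symmetric]
    by (simp add: pull_vfield_nth[OF formal_const[OF f]])
  finally show "as_vector_field L0 (conn_at_0 A (nabla_plus L) (as_vector_field L0 s) t) f b
      - as_vector_field L0 (conn_at_0 A (nabla_plus L) (as_vector_field L0 t) s) f b
      = bracket (as_vector_field L0 s) (as_vector_field L0 t) f b" .
qed

lemma legendre_at_0: "legendre_structure smth (vector_fields smth) L0"
  unfolding legendre_structure_def
  using splitting_at_0 pairing_at_0 dual_at_0 torsion_free_at_0 PB.conn_at_0_flat MB.conn_at_0_flat
  by simp

sublocale L0: field_legendre_bundle smth "vector_fields smth" L0
  by unfold_locales (rule legendre_at_0 subset_refl two_dvd_one)+

lemma para_kaehler_at_0: "para_kaehler smth H (induced_J L0) (induced_omega L0) (induced_nabla L0)"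
  using L0.para_kaehler[OF L0.frames_rank] by simp

lemma para_kaehler_formal:
  "para_kaehler fsmth (hbundle L) (induced_J L) (induced_omega L) (induced_nabla L)"
proof (rule FL.para_kaehler)
  fix U r e W q f
  assume "(U, r, e) \<in> frames (hplus L)" "(W, q, f) \<in> frames (hminus L)" and ne: "U \<inter> W \<noteq> {}"
  then obtain e' f' where "(U, r, e') \<in> frames P" "(W, q, f') \<in> frames M" by auto
  then show "r = q" using L0.frames_rank[OF _ _ ne] by simp
qed

lemma proj_nth_0:
  assumes "x \<in> fibre (hbundle L) b"
  shows "proj_plus L b x $ 0 = proj_plus L0 b (x $ 0)" "proj_minus L b x $ 0 = proj_minus L0 b (x $ 0)"
proof -
  have "proj_plus L b x $ 0 \<in> fibre (hplus L0) b" "proj_minus L b x $ 0 \<in> fibre (hminus L0) b"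
    using FL.proj_fibre[OF assms] by simp_all
  from L0.proj_plus_sum[OF this] L0.proj_minus_sum[OF this]
  show "proj_plus L b x $ 0 = proj_plus L0 b (x $ 0)" "proj_minus L b x $ 0 = proj_minus L0 b (x $ 0)"
    by (simp_all add: FL.proj_sum flip: fps_add_nth)
qed

lemma J_nth_0: "x \<in> fibre (hbundle L) b \<Longrightarrow> induced_J L b x $ 0 = induced_J L0 b (x $ 0)"
  by (simp only: induced_J_def fps_sub_nth proj_nth_0)

lemma omega_nth_0:
  assumes "x \<in> fibre (hbundle L) b" "y \<in> fibre (hbundle L) b"
  shows "induced_omega L b x y $ 0 = induced_omega L0 b (x $ 0) (y $ 0)"
  using pairing_nth_0[of "induced_J L b x" b y] FL.J_fibre[OF assms(1)] assms(2) J_nth_0[OF assms(1)]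
  by (simp add: induced_omega_def)

lemma nabla_nth_0:
  assumes Z: "Z \<in> vector_fields fsmth" and s: "s \<in> sections fsmth (hbundle L)"
  shows "induced_nabla L Z s b $ 0 = induced_nabla L0 (vfield_at_0 A Z) (\<lambda>y. s y $ 0) b"
  using FL.proj_sections[OF s] PB.conn_at_0_reduction[OF Z] MB.conn_at_0_reduction[OF Z]
  by (simp add: induced_nabla_def flip: proj_nth_0[OF sections_fibre[OF s]])

lemma formal_deformation:
  "formal_deformation A (hbundle L0) (induced_J L0) (induced_omega L0) (induced_nabla L0)
     (hbundle L) (induced_J L) (induced_omega L) (induced_nabla L)"
  unfolding formal_deformation_def
  using para_kaehler_at_0 para_kaehler_formal J_nth_0 omega_nth_0 nabla_nth_0 by auto

end

theorem proposition4:
  fixes A :: "('b::{t2_space, second_countable_topology}, 'e::euclidean_space) atlas"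
    and L :: "('b, 'k::real_normed_field fps, 'h::ab_group_add fps, real fps) legendre"
  assumes "smooth_atlas A"
    and "legendre_family A L"
  shows "para_kaehler (formal_smooth A)
           (hbundle L) (induced_J L) (induced_omega L) (induced_nabla L) \<and>
         classical_legendre A (legendre_at_0 A L) \<and>
         formal_deformation A
           (hbundle (legendre_at_0 A L)) (induced_J (legendre_at_0 A L))
           (induced_omega (legendre_at_0 A L)) (induced_nabla (legendre_at_0 A L))
           (hbundle L) (induced_J L) (induced_omega L) (induced_nabla L)"
proof -
  obtain H P M \<tau>p \<tau>m where L: "legendre_splitting (smooth A) H P M \<tau>p \<tau>m"
    "hbundle L = pull_bundle H" "hplus L = pull_bundle P" "hminus L = pull_bundle M"
    "\<And>b x. x \<in> fibre (hplus L) b \<Longrightarrow> tau_plus L b x = pull_tau_plus A \<tau>p b x"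
    "\<And>b x. x \<in> fibre (hminus L) b \<Longrightarrow> tau_minus L b x = pull_tau_minus A \<tau>m b x"
    "legendre_structure (formal_smooth A) (total_vector_fields A) L"
    using assms(2) unfolding legendre_family_def by blast
  interpret legendre_reduction A L H P M \<tau>p \<tau>m
    using function_sheaf_smooth[OF assms(1)] function_sheaf_formal_smooth[OF assms(1)] L
    by (intro legendre_reduction.intro formal_disk.intro legendre_reduction_axioms.intro)
  have "smooth A UNIV (potential (legendre_at_0 A L))" "strictly_convex A (legendre_at_0 A L)"
    using assms(2) by (simp_all add: legendre_family_def formal_smooth_def legendre_at_0_def)
  then show ?thesis
    using para_kaehler_formal formal_deformation legendre_at_0
    by (simp add: classical_legendre_def)
qed

end
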